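(* Let $(\Omega,\mathcal F,(\mathcal F_t)_{t\in\mathbb R_+})$ be a filtered space with right-continuous filtration and $\mathcal F=\bigvee_t\mathcal F_t$, and let $\mu$ and $\nu$ be two probability measures on it. If a stopping time $T$ is predictable and a sequence $\{V_n\}$ is an announcing sequence for $T$, then $$\|(\mu_{T-})_a\|=\liminf_{n\to\infty,\ \alpha\to1-0}H(\alpha;\mu_{V_n},\nu_{V_n})\quad\text{and}\quad\frac{d(\mu_{T-})_a}{d\nu_{T-}}=\lim_{n\to\infty}\frac{d(\mu_{V_n})_a}{d\nu_{V_n}},\quad\nu_{T-}\text{-a.s.},$$ where $(\mu_{T-})_a$ is the absolutely continuous part of $\mu_{T-}$ with respect to $\nu_{T-}$ (and $(\mu_{V_n})_a$ that of $\mu_{V_n}$ with respect to $\nu_{V_n}$).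
   Context: Stopping times take values in $[0,\infty]$. $\mathcal F_{T-}$ is the $\sigma$-algebra generated by $\mathcal F_0$ and the sets $A\cap\{t<T\}$, $A\in\mathcal F_t$, $t\ge0$; $\mu_{T-}$ (resp. $\mu_V$) is the restriction of $\mu$ to $\mathcal F_{T-}$ (resp. $\mathcal F_V$), and similarly for $\nu$. An announcing sequence for $T$ is a nondecreasing sequence of stopping times $V_n$ with $\lim_nV_n=T$ and $V_n<T$ on $\{T>0\}$ for all $n$. For finite measures $\rho,\sigma$ on the same space, $H(\alpha;\rho,\sigma)=\int\big(\frac{d\rho}{d\sigma}\big)^{\alpha}d\sigma$, where $\frac{d\rho}{d\sigma}$ is the density of the absolutely continuous part of $\rho$ with respect to $\sigma$. $\|\cdot\|$ is the total variation norm. The double lower limit is defined by $$\liminf_{n\to\infty,\ \alpha\to1-0}f(\alpha,n)=\sup_{n\in\mathbb N,\ \beta\in(0,1)}\ \inf_{m\ge n,\ x\in[\beta,1)}f(x,m).$$ *)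

theory Defs
  imports "HOL-Probability.Probability"
begin

section \<open>Filtered spaces and predictable times\<close>

text \<open>
  Time is indexed by \<^typ>\<open>ennreal\<close>, so that the library notions \<^locale>\<open>filtration\<close>,
  \<^const>\<open>stopping_time\<close> and \<open>filtration.pre_sigma\<close> cover stopping times with values in
  \<open>[0, \<infinity>]\<close>. The filtration proper is \<open>F t\<close> for \<open>t < \<infinity>\<close>; the component \<open>F \<infinity>\<close> is by
  convention the ambient \<open>\<sigma>\<close>-algebra. With it, a random time \<open>T\<close> satisfies
  \<open>stopping_time F T\<close> iff \<open>{T \<le> t} \<in> F t\<close> for all real \<open>t \<ge> 0\<close>, and \<open>pre_sigma T\<close> consists of the
  \<open>A \<in> \<F>\<close> with \<open>A \<inter> {T \<le> t} \<in> F t\<close> for all real \<open>t \<ge> 0\<close>. Of \<open>M\<close> and \<open>F t\<close> only the underlying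
  measurable spaces are used.
\<close>

locale right_continuous_filtered_space = filtration "space M" F
  for M :: "'a measure" and F :: "ennreal \<Rightarrow> 'a measure" +
  assumes right_continuous: "\<And>t. t < \<infinity> \<Longrightarrow> sets (F t) = (\<Inter>s\<in>{t<..<\<infinity>}. sets (F s))"
    and sets_F_top: "sets (F \<infinity>) = sets M"
    and sets_eq_join: "sets M = sigma_sets (space M) (\<Union>t\<in>{..<\<infinity>}. sets (F t))"

definition strict_past :: "'a set \<Rightarrow> (ennreal \<Rightarrow> 'a measure) \<Rightarrow> ('a \<Rightarrow> ennreal) \<Rightarrow> 'a measure" where
  "strict_past \<Omega> F T =
     sigma \<Omega> (sets (F 0) \<union> {A \<inter> {\<omega> \<in> \<Omega>. t < T \<omega>} | A t. t < \<infinity> \<and> A \<in> sets (F t)})"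

definition announcing_sequence ::
  "'a set \<Rightarrow> (ennreal \<Rightarrow> 'a measure) \<Rightarrow> ('a \<Rightarrow> ennreal) \<Rightarrow> (nat \<Rightarrow> 'a \<Rightarrow> ennreal) \<Rightarrow> bool" where
  "announcing_sequence \<Omega> F T V \<longleftrightarrow>
     (\<forall>n. stopping_time F (V n)) \<and>
     (\<forall>\<omega>\<in>\<Omega>. incseq (\<lambda>n. V n \<omega>) \<and> (\<lambda>n. V n \<omega>) \<longlonglongrightarrow> T \<omega> \<and> (T \<omega> > 0 \<longrightarrow> (\<forall>n. V n \<omega> < T \<omega>)))"

definition predictable_time ::
  "'a set \<Rightarrow> (ennreal \<Rightarrow> 'a measure) \<Rightarrow> ('a \<Rightarrow> ennreal) \<Rightarrow> bool" where
  "predictable_time \<Omega> F T \<longleftrightarrow> stopping_time F T \<and> (\<exists>V. announcing_sequence \<Omega> F T V)"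


section \<open>Lebesgue decomposition\<close>

definition mutually_singular :: "'a measure \<Rightarrow> 'a measure \<Rightarrow> bool" where
  "mutually_singular \<rho> \<sigma> \<longleftrightarrow>
     (\<exists>N\<in>sets \<sigma>. emeasure \<sigma> N = 0 \<and> emeasure \<rho> (space \<sigma> - N) = 0)"

definition lebesgue_decomposition ::
  "'a measure \<Rightarrow> 'a measure \<Rightarrow> 'a measure \<Rightarrow> 'a measure \<Rightarrow> bool" where
  "lebesgue_decomposition \<rho> \<sigma> \<rho>a \<rho>s \<longleftrightarrow>
     sets \<rho>a = sets \<sigma> \<and> sets \<rho>s = sets \<sigma> \<and>
     absolutely_continuous \<sigma> \<rho>a \<and> mutually_singular \<rho>s \<sigma> \<and>
     (\<forall>A\<in>sets \<sigma>. emeasure \<rho> A = emeasure \<rho>a A + emeasure \<rho>s A)"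

definition ac_part :: "'a measure \<Rightarrow> 'a measure \<Rightarrow> 'a measure" where
  "ac_part \<rho> \<sigma> = (THE \<rho>a. \<exists>\<rho>s. lebesgue_decomposition \<rho> \<sigma> \<rho>a \<rho>s)"

lemma lebesgue_decomposition_unique:
  assumes d: "lebesgue_decomposition \<rho> \<sigma> a s" and d': "lebesgue_decomposition \<rho> \<sigma> a' s'"
  shows "a = a'"
proof -
  have key: "emeasure a A = emeasure \<rho> (A - N)"
    if d: "lebesgue_decomposition \<rho> \<sigma> a s"
      and S: "S \<in> sets \<sigma>" "emeasure s (space \<sigma> - S) = 0"
      and N: "N \<in> null_sets \<sigma>" "S \<subseteq> N" and A: "A \<in> sets \<sigma>" for a s S N A
  proof -
    have sets: "sets a = sets \<sigma>" "sets s = sets \<sigma>" and ac: "absolutely_continuous \<sigma> a"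
      and eq: "\<And>A. A \<in> sets \<sigma> \<Longrightarrow> emeasure \<rho> A = emeasure a A + emeasure s A"
      using d by (auto simp: lebesgue_decomposition_def)
    have AN: "A - N \<in> sets \<sigma>" using A N by auto
    have "emeasure s (A - N) \<le> emeasure s (space \<sigma> - S)"
      using sets.sets_into_space[OF A] N S sets by (intro emeasure_mono) auto
    then have "emeasure s (A - N) = 0" using S by simp
    moreover have "emeasure a (A - N) = emeasure a A"
    proof (rule emeasure_Diff_null_set)
      show "N \<in> null_sets a" using N ac by (auto simp: absolutely_continuous_def)
      show "A \<in> sets a" using A sets by simp
    qed
    ultimately show ?thesis using eq[OF AN] by simp
  qed
  obtain S where S: "S \<in> sets \<sigma>" "emeasure \<sigma> S = 0" "emeasure s (space \<sigma> - S) = 0"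
    using d by (auto simp: lebesgue_decomposition_def mutually_singular_def)
  obtain S' where S': "S' \<in> sets \<sigma>" "emeasure \<sigma> S' = 0" "emeasure s' (space \<sigma> - S') = 0"
    using d' by (auto simp: lebesgue_decomposition_def mutually_singular_def)
  have N: "S \<union> S' \<in> null_sets \<sigma>" using S S' by (intro null_sets.Un) auto
  show ?thesis
  proof (rule measure_eqI)
    show "sets a = sets a'" using d d' by (auto simp: lebesgue_decomposition_def)
    fix A assume "A \<in> sets a"
    then have "A \<in> sets \<sigma>" using d by (auto simp: lebesgue_decomposition_def)
    then show "emeasure a A = emeasure a' A"
      using key[OF d S(1,3) N] key[OF d' S'(1,3) N] by simp
  qed
qed

lemma lebesgue_decomposition_exists:
  assumes "finite_measure \<rho>" and sets: "sets \<rho> = sets \<sigma>"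
  shows "\<exists>a s. lebesgue_decomposition \<rho> \<sigma> a s"
proof -
  interpret finite_measure \<rho> by fact
  define c where "c = (SUP A\<in>null_sets \<sigma>. emeasure \<rho> A)"
  have "null_sets \<sigma> \<noteq> {}" by auto
  then obtain f :: "nat \<Rightarrow> ennreal"
    where f: "range f \<subseteq> emeasure \<rho> ` null_sets \<sigma>" "c = (SUP i. f i)"
    using ennreal_Sup_countable_SUP[of "emeasure \<rho> ` null_sets \<sigma>"] unfolding c_def by auto
  then have "\<forall>i. \<exists>A. A \<in> null_sets \<sigma> \<and> f i = emeasure \<rho> A" by auto
  then obtain B where B: "\<And>i. B i \<in> null_sets \<sigma>" "\<And>i. f i = emeasure \<rho> (B i)" by metis
  define N where "N = (\<Union>i. B i)"
  have N: "N \<in> null_sets \<sigma>" unfolding N_def using B by auto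
  then have N': "N \<in> sets \<rho>" using sets by auto
  have "c \<le> emeasure \<rho> N" unfolding f(2)
    by (intro SUP_least, subst B(2), intro emeasure_mono N') (auto simp: N_def)
  have max: "emeasure \<rho> A \<le> emeasure \<rho> N" if "A \<in> null_sets \<sigma>" for A
    using that \<open>c \<le> _\<close> by (auto simp: c_def intro: order_trans[OF SUP_upper])
  define a where "a = density \<rho> (indicator (space \<rho> - N))"
  define s where "s = density \<rho> (indicator N)"
  have em: "emeasure a A = emeasure \<rho> (A - N)" "emeasure s A = emeasure \<rho> (A \<inter> N)"
    if "A \<in> sets \<sigma>" for A
  proof -
    have A: "A \<in> sets \<rho>" using that sets by simp
    have "(space \<rho> - N) \<inter> A = A - N" using sets.sets_into_space[OF A] by auto
    then show "emeasure a A = emeasure \<rho> (A - N)" "emeasure s A = emeasure \<rho> (A \<inter> N)"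
      using A N' by (simp_all add: a_def s_def emeasure_restricted Int_commute)
  qed
  have sp: "space \<sigma> = space \<rho>" using sets by (metis sets_eq_imp_space_eq)
  have "lebesgue_decomposition \<rho> \<sigma> a s"
    unfolding lebesgue_decomposition_def
  proof (intro conjI ballI)
    show "sets a = sets \<sigma>" "sets s = sets \<sigma>" by (auto simp: a_def s_def sets)
    show "absolutely_continuous \<sigma> a" unfolding absolutely_continuous_def
    proof
      fix A assume A: "A \<in> null_sets \<sigma>"
      have "emeasure \<rho> (A - N) + emeasure \<rho> N = emeasure \<rho> (A \<union> N)"
        using A N' sets by (subst plus_emeasure) (auto intro!: arg_cong[where f="emeasure \<rho>"])
      also have "\<dots> \<le> 0 + emeasure \<rho> N" using max[of "A \<union> N"] A N by auto
      finally have "emeasure \<rho> (A - N) = 0"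
        using emeasure_finite[of N] by (metis ennreal_add_left_cancel_le add.commute le_zero_eq infinity_ennreal_def)
      then show "A \<in> null_sets a" using A em(1)[of A] sets by (auto simp: null_sets_def a_def)
    qed
    show "mutually_singular s \<sigma>" unfolding mutually_singular_def
      using N em(2)[of "space \<sigma> - N"] by (intro bexI[of _ N]) (auto simp: Int_commute)
    fix A assume A: "A \<in> sets \<sigma>"
    have "emeasure \<rho> (A - N) + emeasure \<rho> (A \<inter> N) = emeasure \<rho> A"
      using A N' sets by (subst plus_emeasure) (auto intro!: arg_cong[where f="emeasure \<rho>"])
    then show "emeasure \<rho> A = emeasure a A + emeasure s A" using em[OF A] by simp
  qed
  then show ?thesis by blast
qed

lemma lebesgue_decomposition_ac_part:
  assumes "finite_measure \<rho>" "sets \<rho> = sets \<sigma>"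
  shows "\<exists>\<rho>s. lebesgue_decomposition \<rho> \<sigma> (ac_part \<rho> \<sigma>) \<rho>s"
proof -
  obtain a s where d: "lebesgue_decomposition \<rho> \<sigma> a s"
    using lebesgue_decomposition_exists[OF assms] by blast
  have "ac_part \<rho> \<sigma> = a"
    unfolding ac_part_def
  proof (rule the_equality)
    show "\<exists>s. lebesgue_decomposition \<rho> \<sigma> a s" using d by blast
    show "a' = a" if "\<exists>s. lebesgue_decomposition \<rho> \<sigma> a' s" for a'
      using that lebesgue_decomposition_unique[OF _ d] by blast
  qed
  then show ?thesis using d by blast
qed

definition ac_density :: "'a measure \<Rightarrow> 'a measure \<Rightarrow> 'a \<Rightarrow> ennreal" where
  "ac_density \<rho> \<sigma> = RN_deriv \<sigma> (ac_part \<rho> \<sigma>)"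

text \<open>The Hellinger integral of order \<open>\<alpha> \<in> (0, 1)\<close>; the density is \<open>\<sigma>\<close>-a.e. finite.\<close>

definition hellinger_integral :: "real \<Rightarrow> 'a measure \<Rightarrow> 'a measure \<Rightarrow> ennreal" where
  "hellinger_integral \<alpha> \<rho> \<sigma> = (\<integral>\<^sup>+x. ennreal (enn2real (ac_density \<rho> \<sigma> x) powr \<alpha>) \<partial>\<sigma>)"

text \<open>Total variation of a measure; no absolute values occur since measures are nonnegative.\<close>

definition total_variation_norm :: "'a measure \<Rightarrow> ennreal" where
  "total_variation_norm M =
     (SUP P\<in>{P. finite P \<and> partition_on (space M) P \<and> P \<subseteq> sets M}. \<Sum>A\<in>P. emeasure M A)"

definition double_liminf :: "(real \<Rightarrow> nat \<Rightarrow> ennreal) \<Rightarrow> ennreal" where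
  "double_liminf f = (SUP (n, \<beta>)\<in>UNIV \<times> {0<..<1}. INF (m, x)\<in>{n..} \<times> {\<beta>..<1}. f x m)"

end

theory Submission
  imports Defs
begin

text \<open>
  Let \<open>\<lambda> = \<mu> + \<nu>\<close> on \<open>F\<^sub>T\<^sub>-\<close>, which is generated by the increasing \<open>\<sigma>\<close>-algebras \<open>F\<^sub>V\<^sub>n\<close>, and let
  \<open>f = d\<mu>/d\<lambda>\<close>, so that \<open>0 \<le> f \<le> 1\<close> and \<open>d\<nu>/d\<lambda> = 1 - f\<close>. On \<open>F\<^sub>V\<^sub>n\<close> the corresponding densities are
  \<open>g\<^sub>n = E\<^sub>\<lambda>[f | F\<^sub>V\<^sub>n]\<close> and \<open>1 - g\<^sub>n\<close>, and \<open>g\<^sub>n \<longlonglongrightarrow> f\<close> almost everywhere by Levy's upward theorem. The densities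
  of the absolutely continuous parts are \<open>g\<^sub>n / (1 - g\<^sub>n)\<close> and \<open>f / (1 - f)\<close>, whence the second claim.
  Moreover the Hellinger integral of order \<open>\<alpha>\<close> is \<open>\<integral> g\<^sub>n\<^sup>\<alpha> (1 - g\<^sub>n)\<^sup>1\<^sup>-\<^sup>\<alpha> d\<lambda>\<close>, whose integrand is bounded by
  1. Fatou's lemma along \<open>n \<rightarrow> \<infinity>, \<alpha> \<rightarrow> 1\<close> gives the lower bound \<open>\<integral>\<^bsub>{f < 1}\<^esub> f d\<lambda>\<close> for the double lower limit;
  bounded convergence, first in \<open>n\<close> and then in \<open>\<alpha>\<close>, gives the same upper bound.
\<close>

section \<open>Levy's upward theorem, by a maximal inequality and L1 approximation\<close>

section \<open>Upward convergence of conditional expectations\<close>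

text \<open>Finite rather than probability measures are allowed because the theorem is applied to
  the sum of two measures.\<close>

locale generating_filtration = finite_measure M for M :: "'a measure" +
  fixes G :: "nat \<Rightarrow> 'a measure"
  assumes subalg: "\<And>n. subalgebra M (G n)"
    and sets_mono: "\<And>m n. m \<le> n \<Longrightarrow> sets (G m) \<subseteq> sets (G n)"
    and generates: "sets M = sigma_sets (space M) (\<Union>n. sets (G n))"
begin

lemma sigma_finite_subalgebra: "sigma_finite_subalgebra M (G n)"
proof -
  interpret finite_measure_subalgebra M "G n"
    by unfold_locales (rule subalg)
  show ?thesis by unfold_locales
qed

lemma space_G: "space (G n) = space M"
  using subalg[of n] by (simp add: subalgebra_def)

lemma sets_G: "sets (G n) \<subseteq> sets M"
  using subalg[of n] by (simp add: subalgebra_def)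

lemma measurable_G_mono: "m \<le> n \<Longrightarrow> h \<in> measurable (G m) N \<Longrightarrow> h \<in> measurable (G n) N"
  using sets_mono[of m n] by (auto simp: measurable_def space_G)

lemma integrable_indicator_real: "A \<in> sets M \<Longrightarrow> integrable M (indicator A :: 'a \<Rightarrow> real)"
  by (intro integrable_real_indicator) (auto simp: less_top[symmetric])

text \<open>Doob's maximal inequality. The event is cut according to the first index at which the
  level \<open>c\<close> is exceeded. Each piece is measurable at its own index, so the conditional
  expectation integrates over it like \<open>h\<close> itself, and the disjoint pieces add up to at
  most the integral of \<open>h\<close>.\<close>

lemma nn_cond_exp_maximal_inequality:
  fixes h :: "'a \<Rightarrow> ennreal"
  assumes [measurable]: "h \<in> borel_measurable M"
  shows "c * emeasure M {x\<in>space M. \<exists>n. nn_cond_exp M (G n) h x > c} \<le> (\<integral>\<^sup>+x. h x \<partial>M)"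
proof -
  let ?E = "\<lambda>n. nn_cond_exp M (G n) h"
  \<comment> \<open>\<open>A n\<close> says that \<open>n\<close> is the first index of exceedance;
    it involves only indices up to \<open>n\<close> and therefore belongs to
    \<open>G n\<close>.\<close>
  define A where "A n = {x\<in>space M. ?E n x > c \<and> (\<forall>k<n. ?E k x \<le> c)}" for n
  have A_G: "A n \<in> sets (G n)" for n
  proof -
    have E: "?E k \<in> borel_measurable (G n)" if "k \<le> n" for k
      by (rule measurable_G_mono[OF that]) simp
    have "{x\<in>space (G n). ?E n x > c \<and> (\<forall>k\<in>{..<n}. ?E k x \<le> c)} \<in> sets (G n)"
      using E by (intro sets.sets_Collect sets.sets_Collect_finite_All borel_measurable_less borel_measurable_le) auto
    also have "{x\<in>space (G n). ?E n x > c \<and> (\<forall>k\<in>{..<n}. ?E k x \<le> c)} = A n"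
      unfolding A_def space_G by blast
    finally show ?thesis .
  qed
  have A_M [measurable]: "A n \<in> sets M" for n using A_G[of n] sets_G[of n] by (rule set_rev_mp)
  have disj: "disjoint_family A"
    unfolding disjoint_family_on_def A_def
  proof (safe, goal_cases)
    case (1 m n x)
    then show ?case by (cases m n rule: linorder_cases) (auto simp: not_less[symmetric])
  qed
  have "{x\<in>space M. \<exists>n. ?E n x > c} = (\<Union>n. A n)"
  proof (intro equalityI subsetI)
    fix x assume "x \<in> {x\<in>space M. \<exists>n. ?E n x > c}"
    then have x: "x \<in> space M" and ex: "\<exists>n. ?E n x > c" by auto
    obtain n where "?E n x > c" "\<forall>k<n. \<not> ?E k x > c"
      using exists_least_iff[THEN iffD1, OF ex] by blast
    then have "x \<in> A n" unfolding A_def using x by (simp add: not_less)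
    then show "x \<in> (\<Union>n. A n)" by blast
  qed (auto simp: A_def)
  then have "c * emeasure M {x\<in>space M. \<exists>n. ?E n x > c} = c * (\<Sum>n. emeasure M (A n))"
    using suminf_emeasure[of A M] disj A_M by (simp add: image_subset_iff)
  also have "\<dots> = (\<Sum>n. c * emeasure M (A n))" by simp
  also have "\<dots> \<le> (\<Sum>n. \<integral>\<^sup>+x. indicator (A n) x * h x \<partial>M)"
  proof (rule suminf_le)
    fix n
    interpret sigma_finite_subalgebra M "G n" by (rule sigma_finite_subalgebra)
    have "c * emeasure M (A n) = (\<integral>\<^sup>+x. c * indicator (A n) x \<partial>M)"
      by (simp add: nn_integral_cmult_indicator)
    also have "\<dots> \<le> (\<integral>\<^sup>+x. indicator (A n) x * ?E n x \<partial>M)"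
      by (intro nn_integral_mono) (auto simp: A_def indicator_def less_imp_le)
    also have "\<dots> = (\<integral>\<^sup>+x. indicator (A n) x * h x \<partial>M)"
      using A_G[of n] by (intro nn_cond_exp_intg) auto
    finally show "c * emeasure M (A n) \<le> (\<integral>\<^sup>+x. indicator (A n) x * h x \<partial>M)" .
  qed auto
  also have "\<dots> = (\<integral>\<^sup>+x. (\<Sum>n. indicator (A n) x * h x) \<partial>M)"
    by (rule nn_integral_suminf[symmetric]) simp
  also have "\<dots> = (\<integral>\<^sup>+x. indicator (\<Union>n. A n) x * h x \<partial>M)"
    by (simp add: suminf_indicator[OF disj])
  also have "\<dots> \<le> (\<integral>\<^sup>+x. h x \<partial>M)"
    by (intro nn_integral_mono) (auto simp: indicator_def)
  finally show ?thesis .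
qed

text \<open>The maximal inequality bounds the conditional expectations of \<open>h - s k\<close> for
  all \<open>n\<close> at once, so convergence for an approximant passes to \<open>h\<close> with an
  error that is small outside a small set. This makes the class of functions with the convergence
  property closed under L1 limits.\<close>

lemma real_cond_exp_tendsto_L1_closed:
  fixes h :: "'a \<Rightarrow> real" and s :: "nat \<Rightarrow> 'a \<Rightarrow> real"
  assumes h: "integrable M h" and s: "\<And>k. integrable M (s k)"
    and L1: "(\<lambda>k. \<integral>\<^sup>+x. ennreal \<bar>h x - s k x\<bar> \<partial>M) \<longlonglongrightarrow> 0"
    and conv: "\<And>k. AE x in M. (\<lambda>n. real_cond_exp M (G n) (s k) x) \<longlonglongrightarrow> s k x"
  shows "AE x in M. (\<lambda>n. real_cond_exp M (G n) h x) \<longlonglongrightarrow> h x"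
proof -
  note [measurable] = borel_measurable_integrable[OF h] borel_measurable_integrable[OF s]
  let ?E = "\<lambda>n. real_cond_exp M (G n)"
  let ?N = "\<lambda>k n. nn_cond_exp M (G n) (\<lambda>x. ennreal \<bar>h x - s k x\<bar>)"
  have NM [measurable]: "?N k n \<in> borel_measurable M" for k n
    by (rule measurable_from_subalg[OF subalg[of n]]) simp
  have near: "AE x in M. \<exists>k. (\<forall>n. ?N k n x \<le> ennreal d) \<and> \<bar>h x - s k x\<bar> \<le> d" if d: "d > 0" for d :: real
  proof -
    define B where "B k = {x\<in>space M. \<exists>n. ?N k n x > ennreal d}" for k
    define C where "C k = {x\<in>space M. ennreal \<bar>h x - s k x\<bar> \<ge> ennreal d}" for k
    have [measurable]: "B k \<in> sets M" "C k \<in> sets M" for k by (simp_all add: B_def C_def)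
    \<comment> \<open>Outside \<open>D\<close> some single \<open>k\<close> serves all
      \<open>n\<close>. For every \<open>k\<close>, \<open>D\<close> lies in
      \<open>B k \<union> C k\<close>; the maximal inequality bounds the first part and Markov's
      inequality the second, each by the L1 distance over \<open>d\<close>. Letting \<open>k\<close>
      grow makes \<open>D\<close> null.\<close>
    define D where "D = (\<Inter>k. B k \<union> C k)"
    have [measurable]: "D \<in> sets M" by (simp add: D_def)
    have le: "ennreal d * emeasure M D \<le> 2 * (\<integral>\<^sup>+x. ennreal \<bar>h x - s k x\<bar> \<partial>M)" for k
    proof -
      have "emeasure M D \<le> emeasure M (B k \<union> C k)"
        by (rule emeasure_mono) (auto simp: D_def)
      also have "\<dots> \<le> emeasure M (B k) + emeasure M (C k)"
        by (rule emeasure_subadditive) auto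
      finally have "ennreal d * emeasure M D \<le> ennreal d * emeasure M (B k) + ennreal d * emeasure M (C k)"
        by (metis distrib_left mult_left_mono zero_le)
      also have "ennreal d * emeasure M (B k) \<le> (\<integral>\<^sup>+x. ennreal \<bar>h x - s k x\<bar> \<partial>M)"
        unfolding B_def by (rule nn_cond_exp_maximal_inequality) simp
      also have "ennreal d * emeasure M (C k) = (\<integral>\<^sup>+x. ennreal d * indicator (C k) x \<partial>M)"
        by (simp add: nn_integral_cmult_indicator)
      also have "\<dots> \<le> (\<integral>\<^sup>+x. ennreal \<bar>h x - s k x\<bar> \<partial>M)"
        by (intro nn_integral_mono) (auto simp: C_def indicator_def)
      finally show ?thesis by (simp add: mult_2)
    qed
    have "(\<lambda>k. 2 * (\<integral>\<^sup>+x. ennreal \<bar>h x - s k x\<bar> \<partial>M)) \<longlonglongrightarrow> 2 * 0"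
      by (intro tendsto_intros ennreal_tendsto_cmult L1) auto
    then have "ennreal d * emeasure M D \<le> 2 * 0"
      by (rule LIMSEQ_le_const) (use le in auto)
    then have "D \<in> null_sets M" using d by auto
    then have "AE x in M. x \<notin> D" by (rule AE_not_in)
    with AE_space show ?thesis
    proof eventually_elim
      case (elim x)
      then obtain k where "x \<notin> B k" "x \<notin> C k" by (auto simp: D_def)
      with elim show ?case using d by (auto simp: B_def C_def not_less not_le intro!: exI[of _ k])
    qed
  qed
  \<comment> \<open>Tolerances \<open>1 / Suc j\<close> suffice; being countably many, like the
    indices \<open>k\<close> and \<open>n\<close>, they leave one common null set outside which
    everything is pointwise.\<close>
  have "AE x in M. \<forall>j. \<exists>k. (\<forall>n. ?N k n x \<le> ennreal (1 / Suc j)) \<and> \<bar>h x - s k x\<bar> \<le> 1 / Suc j"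
    unfolding AE_all_countable by (intro allI near) simp
  moreover have "AE x in M. \<forall>k n. ?E n h x - ?E n (s k) x = ?E n (\<lambda>x. h x - s k x) x"
    unfolding AE_all_countable
  proof (intro allI)
    fix k n
    interpret sigma_finite_subalgebra M "G n" by (rule sigma_finite_subalgebra)
    show "AE x in M. ?E n h x - ?E n (s k) x = ?E n (\<lambda>x. h x - s k x) x"
      using real_cond_exp_diff[OF h s[of k]] by eventually_elim simp
  qed
  moreover have "AE x in M. \<forall>k n. ennreal \<bar>?E n (\<lambda>x. h x - s k x) x\<bar> \<le> ?N k n x"
    unfolding AE_all_countable
  proof (intro allI)
    fix k n
    interpret sigma_finite_subalgebra M "G n" by (rule sigma_finite_subalgebra)
    show "AE x in M. ennreal \<bar>?E n (\<lambda>x. h x - s k x) x\<bar> \<le> ?N k n x"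
      by (rule real_cond_exp_abs) simp
  qed
  moreover have "AE x in M. \<forall>k. (\<lambda>n. ?E n (s k) x) \<longlonglongrightarrow> s k x"
    unfolding AE_all_countable using conv by blast
  ultimately show ?thesis
  proof eventually_elim
    case (elim x)
    show ?case
    proof (rule LIMSEQ_I)
      fix r :: real assume "r > 0"
      \<comment> \<open>One third of \<open>r\<close> is spent on each of three errors: the
        conditional expectation of \<open>h - s k\<close>, the convergence for \<open>s k\<close>,
        and the distance of \<open>s k x\<close> from \<open>h x\<close>.\<close>
      then obtain j where j: "1 / real (Suc j) < r / 3"
        by (metis nat_approx_posE divide_pos_pos zero_less_numeral)
      obtain k where k: "\<And>n. ?N k n x \<le> ennreal (1 / Suc j)" "\<bar>h x - s k x\<bar> \<le> 1 / Suc j"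
        using elim(1) by blast
      obtain n0 where n0: "\<And>n. n \<ge> n0 \<Longrightarrow> \<bar>?E n (s k) x - s k x\<bar> < r / 3"
        using LIMSEQ_D[of "\<lambda>n. ?E n (s k) x" "s k x" "r / 3"] elim(4) \<open>r > 0\<close> by auto
      have "\<bar>?E n h x - h x\<bar> < r" if "n \<ge> n0" for n
      proof -
        have "ennreal \<bar>?E n (\<lambda>x. h x - s k x) x\<bar> \<le> ennreal (1 / Suc j)"
          using elim(3) k(1) order_trans by blast
        then have "\<bar>?E n (\<lambda>x. h x - s k x) x\<bar> \<le> 1 / Suc j" by simp
        moreover have "?E n h x - ?E n (s k) x = ?E n (\<lambda>x. h x - s k x) x" using elim(2) by blast
        ultimately show ?thesis using n0[OF that] k(2) j by linarith
      qed
      then show "\<exists>n0. \<forall>n\<ge>n0. norm (?E n h x - h x) < r" by auto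
    qed
  qed
qed

section \<open>Closure properties of the convergence, from measurable functions to all integrable
  ones\<close>

lemma real_cond_exp_tendsto_add:
  fixes f h :: "'a \<Rightarrow> real"
  assumes "integrable M f" "integrable M h"
    and "AE x in M. (\<lambda>n. real_cond_exp M (G n) f x) \<longlonglongrightarrow> f x"
    and "AE x in M. (\<lambda>n. real_cond_exp M (G n) h x) \<longlonglongrightarrow> h x"
  shows "AE x in M. (\<lambda>n. real_cond_exp M (G n) (\<lambda>x. f x + h x) x) \<longlonglongrightarrow> f x + h x"
proof -
  have "AE x in M. \<forall>n. real_cond_exp M (G n) (\<lambda>x. f x + h x) x
      = real_cond_exp M (G n) f x + real_cond_exp M (G n) h x"
    unfolding AE_all_countable
    using sigma_finite_subalgebra.real_cond_exp_add[OF sigma_finite_subalgebra] assms by blast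
  with assms(3,4) show ?thesis
    by eventually_elim (simp add: tendsto_add)
qed

lemma real_cond_exp_tendsto_cmult:
  fixes f :: "'a \<Rightarrow> real"
  assumes "integrable M f"
    and "AE x in M. (\<lambda>n. real_cond_exp M (G n) f x) \<longlonglongrightarrow> f x"
  shows "AE x in M. (\<lambda>n. real_cond_exp M (G n) (\<lambda>x. c * f x) x) \<longlonglongrightarrow> c * f x"
proof -
  have "AE x in M. \<forall>n. real_cond_exp M (G n) (\<lambda>x. c * f x) x = c * real_cond_exp M (G n) f x"
    unfolding AE_all_countable
    using sigma_finite_subalgebra.real_cond_exp_cmult[OF sigma_finite_subalgebra] assms by blast
  with assms(2) show ?thesis
    by eventually_elim (simp add: tendsto_mult_left)
qed

text \<open>From index \<open>m\<close> on, conditioning leaves \<open>h\<close> unchanged almost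
  everywhere, so the sequence is eventually constant.\<close>

lemma real_cond_exp_tendsto_measurable:
  fixes h :: "'a \<Rightarrow> real"
  assumes "integrable M h" "h \<in> borel_measurable (G m)"
  shows "AE x in M. (\<lambda>n. real_cond_exp M (G n) h x) \<longlonglongrightarrow> h x"
proof -
  have "AE x in M. \<forall>n. m \<le> n \<longrightarrow> real_cond_exp M (G n) h x = h x"
    unfolding AE_all_countable
    using sigma_finite_subalgebra.real_cond_exp_F_meas[OF sigma_finite_subalgebra assms(1)]
      measurable_G_mono[OF _ assms(2)] by auto
  then show ?thesis
    by eventually_elim (auto simp: eventually_sequentially intro!: tendsto_eventually exI[of _ m])
qed

text \<open>A Dynkin argument: the union of the increasing sigma-algebras is stable under
  intersection and generates, and the sets with the property are closed under complements and
  countable disjoint unions.\<close>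

lemma real_cond_exp_indicator_tendsto:
  assumes "A \<in> sets M"
  shows "AE x in M. (\<lambda>n. real_cond_exp M (G n) (indicator A) x) \<longlonglongrightarrow> indicator A x"
proof -
  let ?P = "\<lambda>A. AE x in M. (\<lambda>n. real_cond_exp M (G n) (indicator A :: 'a \<Rightarrow> real) x) \<longlonglongrightarrow> indicator A x"
  have "Int_stable (\<Union>n. sets (G n))"
  proof (rule Int_stableI)
    fix A B assume "A \<in> (\<Union>n. sets (G n))" "B \<in> (\<Union>n. sets (G n))"
    then obtain m n where "A \<in> sets (G m)" "B \<in> sets (G n)" by auto
    then have "A \<in> sets (G (max m n))" "B \<in> sets (G (max m n))"
      using sets_mono[of m "max m n"] sets_mono[of n "max m n"] by auto
    then show "A \<inter> B \<in> (\<Union>n. sets (G n))" by blast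
  qed
  moreover have "(\<Union>n. sets (G n)) \<subseteq> Pow (space M)"
    using sets.space_closed[of "G _"] by (auto simp: space_G)
  moreover have "A \<in> sigma_sets (space M) (\<Union>n. sets (G n))" using assms generates by simp
  ultimately show ?thesis
  proof (induction rule: sigma_sets_induct_disjoint)
    case (basic A)
    then obtain m where "A \<in> sets (G m)" by auto
    moreover then have "A \<in> sets M" using sets_G by blast
    ultimately show ?case
      by (intro real_cond_exp_tendsto_measurable[of _ m]) (auto simp: integrable_indicator_real)
  next
    case empty
    show ?case
      by (intro real_cond_exp_tendsto_measurable[of _ 0]) auto
  next
    case (compl A)
    then have [measurable]: "A \<in> sets M" by (simp add: generates)
    have one: "?P (space M)"
      by (intro real_cond_exp_tendsto_measurable[of _ 0]) (auto simp: integrable_indicator_real simp flip: space_G[of 0] intro!: subsetD[OF sets_G[of 0]] integrable_indicator_real)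
    \<comment> \<open>The complement enters as one minus the indicator, the constant one being
      measurable already at index 0.\<close>
    have "AE x in M. (\<lambda>n. real_cond_exp M (G n) (\<lambda>x. indicator (space M) x + (-1) * indicator A x) x)
        \<longlonglongrightarrow> indicator (space M) x + (-1) * indicator A x"
      by (intro real_cond_exp_tendsto_add real_cond_exp_tendsto_cmult one compl) (auto simp: integrable_indicator_real)
    moreover have "indicator (space M) x + (-1) * indicator A x = (indicator (space M - A) x :: real)" for x
      using sets.sets_into_space[of A M] by (auto simp: indicator_def)
    ultimately show ?case by (simp only:)
  next
    case (union A)
    then have [measurable]: "A i \<in> sets M" for i by (auto simp: generates)
    \<comment> \<open>By disjointness the finite unions are sums of indicators, which linearity
      handles; they converge in L1 to the full union by bounded convergence on a finite
      measure.\<close>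
    define s :: "nat \<Rightarrow> 'a \<Rightarrow> real" where "s k = indicator (\<Union>i<k. A i)" for k
    have s: "integrable M (s k)" for k by (auto simp: s_def integrable_indicator_real)
    show ?case
    proof (rule real_cond_exp_tendsto_L1_closed)
      show "integrable M (s k)" for k by (rule s)
      show "integrable M (indicator (\<Union>i. A i) :: 'a \<Rightarrow> real)" by (auto simp: integrable_indicator_real)
      show "AE x in M. (\<lambda>n. real_cond_exp M (G n) (s k) x) \<longlonglongrightarrow> s k x" for k
      proof (induction k)
        case 0
        show ?case using union
          by (intro real_cond_exp_tendsto_measurable[of _ 0]) (auto simp: s_def)
      next
        case (Suc k)
        have "s (Suc k) = (\<lambda>x. s k x + indicator (A k) x)"
        proof
          fix x
          have "A i \<inter> A k = {}" if "i < k" for i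
            using union(1) that by (intro disjoint_family_onD) auto
          then have "x \<in> A k \<Longrightarrow> x \<notin> (\<Union>i<k. A i)" by auto
          then show "s (Suc k) x = s k x + indicator (A k) x"
            by (simp add: s_def lessThan_Suc indicator_def)
        qed
        then show ?case
          using real_cond_exp_tendsto_add[OF s[of k] _ Suc union(3)[of k]] by (auto simp: integrable_indicator_real)
      qed
      have "(\<lambda>k. \<integral>\<^sup>+x. ennreal \<bar>indicator (\<Union>i. A i) x - s k x\<bar> \<partial>M) \<longlonglongrightarrow> (\<integral>\<^sup>+x. 0 \<partial>M)"
      proof (rule nn_integral_dominated_convergence[where w="\<lambda>_. 1"])
        show "AE x in M. (\<lambda>k. ennreal \<bar>indicator (\<Union>i. A i) x - s k x\<bar>) \<longlonglongrightarrow> 0"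
        proof (rule AE_I2)
          fix x
          have "(\<lambda>k. s k x) \<longlonglongrightarrow> indicator (\<Union>i. A i) x"
            unfolding s_def by (rule LIMSEQ_indicator_UN)
          then have "(\<lambda>k. ennreal \<bar>indicator (\<Union>i. A i) x - s k x\<bar>) \<longlonglongrightarrow> ennreal \<bar>indicator (\<Union>i. A i) x - indicator (\<Union>i. A i) x\<bar>"
            by (intro tendsto_intros tendsto_ennrealI)
          then show "(\<lambda>k. ennreal \<bar>indicator (\<Union>i. A i) x - s k x\<bar>) \<longlonglongrightarrow> 0" by simp
        qed
      qed (auto simp: s_def indicator_def less_top[symmetric])
      then show "(\<lambda>k. \<integral>\<^sup>+x. ennreal \<bar>indicator (\<Union>i. A i) x - s k x\<bar> \<partial>M) \<longlonglongrightarrow> 0" by simp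
    qed
  qed
qed

theorem real_cond_exp_tendsto:
  fixes h :: "'a \<Rightarrow> real"
  assumes "integrable M h"
  shows "AE x in M. (\<lambda>n. real_cond_exp M (G n) h x) \<longlonglongrightarrow> h x"
  using assms
proof (induction rule: integrable_induct)
  case (base A c)
  have "AE x in M. (\<lambda>n. real_cond_exp M (G n) (\<lambda>x. c * indicator A x) x) \<longlonglongrightarrow> c * indicator A x"
    using base by (intro real_cond_exp_tendsto_cmult real_cond_exp_indicator_tendsto) auto
  then show ?case by (simp add: mult.commute)
next
  case (add f g)
  then show ?case by (intro real_cond_exp_tendsto_add)
next
  case (lim f s)
  have s: "integrable M (s i)" "AE x in M. (\<lambda>n. real_cond_exp M (G n) (s i) x) \<longlonglongrightarrow> s i x" for i
    by fact+
  have f: "integrable M f" by fact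
  have s_lim: "(\<lambda>i. s i x) \<longlonglongrightarrow> f x" and s_le: "norm (s i x) \<le> 2 * norm (f x)" if "x \<in> space M" for i x
    using that lim by auto
  note [measurable] = borel_measurable_integrable[OF s(1)] borel_measurable_integrable[OF f]
  show ?case
  proof (rule real_cond_exp_tendsto_L1_closed[OF f s(1) _ s(2)])
    have "(\<lambda>k. \<integral>\<^sup>+x. ennreal \<bar>f x - s k x\<bar> \<partial>M) \<longlonglongrightarrow> (\<integral>\<^sup>+x. 0 \<partial>M)"
    \<comment> \<open>The factor 3 is one for \<open>f\<close> plus the 2 with which the induction
      bounds the approximants.\<close>
    proof (rule nn_integral_dominated_convergence[where w="\<lambda>x. ennreal (3 * \<bar>f x\<bar>)"])
      show "AE x in M. ennreal \<bar>f x - s k x\<bar> \<le> ennreal (3 * \<bar>f x\<bar>)" for k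
      proof (rule AE_I2)
        fix x assume "x \<in> space M"
        then have "\<bar>s k x\<bar> \<le> 2 * \<bar>f x\<bar>" using s_le[of x k] by simp
        then show "ennreal \<bar>f x - s k x\<bar> \<le> ennreal (3 * \<bar>f x\<bar>)" by (intro ennreal_leI) linarith
      qed
      have "integrable M (\<lambda>x. 3 * \<bar>f x\<bar>)" using f by simp
      then show "(\<integral>\<^sup>+x. ennreal (3 * \<bar>f x\<bar>) \<partial>M) < \<infinity>"
        by (subst nn_integral_eq_integral) auto
      show "AE x in M. (\<lambda>k. ennreal \<bar>f x - s k x\<bar>) \<longlonglongrightarrow> 0"
      proof (rule AE_I2)
        fix x assume "x \<in> space M"
        then have "(\<lambda>k. ennreal \<bar>f x - s k x\<bar>) \<longlonglongrightarrow> ennreal \<bar>f x - f x\<bar>"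
          by (intro tendsto_intros tendsto_ennrealI s_lim)
        then show "(\<lambda>k. ennreal \<bar>f x - s k x\<bar>) \<longlonglongrightarrow> 0" by simp
      qed
    qed auto
    then show "(\<lambda>k. \<integral>\<^sup>+x. ennreal \<bar>f x - s k x\<bar> \<partial>M) \<longlonglongrightarrow> 0" by simp
  qed
qed

end

section \<open>Lebesgue decomposition with respect to a dominating measure\<close>

text \<open>By additivity every finite partition gives the same sum, so the supremum is over a
  constant.\<close>

lemma total_variation_norm_eq: "total_variation_norm N = emeasure N (space N)"
proof -
  let ?S = "{P. finite P \<and> partition_on (space N) P \<and> P \<subseteq> sets N}"
  have "(\<Sum>A\<in>P. emeasure N A) = emeasure N (space N)" if "P \<in> ?S" for P
  proof -
    have "(\<Sum>A\<in>P. emeasure N A) = emeasure N (\<Union>A\<in>P. A)"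
      using that by (intro sum_emeasure)
        (auto simp: partition_on_def disjoint_def disjoint_family_on_def)
    then show ?thesis using that by (simp add: partition_on_def)
  qed
  \<comment> \<open>A partition may not contain the empty set, so an empty space needs the empty
    partition as witness.\<close>
  moreover have "(if space N = {} then {} else {space N}) \<in> ?S"
    by (auto simp: partition_on_def)
  then have "?S \<noteq> {}" by blast
  ultimately show ?thesis
    unfolding total_variation_norm_def by (metis (no_types, lifting) SUP_cong cSUP_const)
qed

lemma emeasure_sum_measure:
  assumes "sets P = sets Q" "A \<in> sets P"
  shows "emeasure (measure_of (space P) (sets P) (\<lambda>A. emeasure P A + emeasure Q A)) A = emeasure P A + emeasure Q A"
proof (rule emeasure_measure_of_sigma)
  show "sigma_algebra (space P) (sets P)" by (rule sets.sigma_algebra_axioms)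
  show "positive (sets P) (\<lambda>A. emeasure P A + emeasure Q A)" by (simp add: positive_def)
  show "countably_additive (sets P) (\<lambda>A. emeasure P A + emeasure Q A)"
    unfolding countably_additive_def
  proof (intro allI impI)
    fix A :: "nat \<Rightarrow> 'a set" assume "range A \<subseteq> sets P" "disjoint_family A"
    then show "(\<Sum>i. emeasure P (A i) + emeasure Q (A i)) = emeasure P (\<Union>i. A i) + emeasure Q (\<Union>i. A i)"
      using assms(1) by (simp add: suminf_add[symmetric] suminf_emeasure)
  qed
qed fact

text \<open>Both measures are absolutely continuous with respect to their sum \<open>L\<close>.
  Their Radon-Nikodym densities add up to 1 almost everywhere, and a change on a null set makes one
  real function \<open>f\<close> describe both, with bounds valid everywhere.\<close>

lemma dominating_densities_exist:
  assumes P: "finite_measure P" and Q: "finite_measure Q" and sets: "sets P = sets Q"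
  obtains L :: "'a measure" and f :: "'a \<Rightarrow> real"
  where "finite_measure L" "sets L = sets P" "f \<in> borel_measurable L"
    "\<And>x. 0 \<le> f x" "\<And>x. f x \<le> 1"
    "P = density L (\<lambda>x. ennreal (f x))" "Q = density L (\<lambda>x. ennreal (1 - f x))"
proof -
  interpret P: finite_measure P by fact
  interpret Q: finite_measure Q by fact
  define L where "L = measure_of (space P) (sets P) (\<lambda>A. emeasure P A + emeasure Q A)"
  have sets_L: "sets L = sets P" by (simp add: L_def)
  have em: "emeasure L A = emeasure P A + emeasure Q A" if "A \<in> sets P" for A
    unfolding L_def by (rule emeasure_sum_measure[OF sets that])
  have sp: "space L = space P" by (simp add: L_def space_measure_of_conv)
  interpret L: finite_measure L
    by (rule finite_measureI) (simp add: sp em P.emeasure_eq_measure Q.emeasure_eq_measure)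
  have "absolutely_continuous L P" "absolutely_continuous L Q"
    by (auto simp: absolutely_continuous_def null_sets_def sets_L em sets[symmetric])
  then obtain p q where pq [measurable]: "p \<in> borel_measurable L" "q \<in> borel_measurable L"
    and p: "density L p = P" and q: "density L q = Q"
    using L.Radon_Nikodym[of P] L.Radon_Nikodym[of Q] sets_L sets by metis
  \<comment> \<open>The sum of the densities is a density of \<open>L\<close> with respect to
    itself; uniqueness makes it 1.\<close>
  have "density L (\<lambda>x. p x + q x) = density L (\<lambda>_. 1)"
  proof (rule measure_eqI)
    fix A assume "A \<in> sets (density L (\<lambda>x. p x + q x))"
    then have A [measurable]: "A \<in> sets L" by simp
    have "emeasure (density L (\<lambda>x. p x + q x)) A = emeasure (density L p) A + emeasure (density L q) A"
      by (simp add: emeasure_density distrib_right nn_integral_add)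
    then show "emeasure (density L (\<lambda>x. p x + q x)) A = emeasure (density L (\<lambda>_. 1)) A"
      using A em[of A] by (simp add: p q sets_L density_1)
  qed simp
  then have pq1: "AE x in L. p x + q x = 1"
    by (subst (asm) L.density_unique_iff) auto
  define f where "f x = enn2real (min 1 (p x))" for x
  have f_ennreal: "ennreal (f x) = min 1 (p x)" for x
    unfolding f_def by (rule ennreal_enn2real) (simp add: min_less_iff_disj)
  have f: "f \<in> borel_measurable L" unfolding f_def by measurable
  have f0: "0 \<le> f x" for x by (simp add: f_def)
  have f1: "f x \<le> 1" for x
  proof -
    have "ennreal (f x) \<le> ennreal 1" by (simp add: f_ennreal)
    then show ?thesis by (simp add: ennreal_le_iff2)
  qed
  have "AE x in L. p x = ennreal (f x) \<and> q x = ennreal (1 - f x)"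
    using pq1
  proof eventually_elim
    case (elim x)
    have "p x \<le> 1" using elim by (metis le_iff_add)
    then have pf: "p x = ennreal (f x)" by (simp add: f_ennreal min_def)
    have "ennreal (f x) + ennreal (1 - f x) = ennreal (f x) + q x"
      using elim f0[of x] f1[of x] pf by (simp flip: ennreal_plus)
    then show ?case using pf by (simp add: ennreal_add_left_cancel)
  qed
  then have "AE x in L. p x = ennreal (f x)" "AE x in L. q x = ennreal (1 - f x)" by auto
  then have "P = density L (\<lambda>x. ennreal (f x))" "Q = density L (\<lambda>x. ennreal (1 - f x))"
    unfolding p[symmetric] q[symmetric] using f by (auto intro!: density_cong)
  then show thesis using that[of L f] L.finite_measure_axioms sets_L f f0 f1 by blast
qed

lemma finite_measure_density_le_1:
  fixes h :: "'a \<Rightarrow> real"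
  assumes "finite_measure L" and [measurable]: "h \<in> borel_measurable L" and "\<And>x. h x \<le> 1"
  shows "finite_measure (density L (\<lambda>x. ennreal (h x)))"
proof (rule finite_measureI)
  interpret finite_measure L by fact
  have "emeasure (density L (\<lambda>x. ennreal (h x))) (space L) \<le> (\<integral>\<^sup>+x. 1 \<partial>L)"
    using assms(3) by (subst emeasure_density)
      (auto intro!: nn_integral_mono simp: indicator_def simp del: nn_integral_const)
  also have "\<dots> < \<infinity>" by (simp add: less_top[symmetric])
  finally show "emeasure (density L (\<lambda>x. ennreal (h x))) (space (density L (\<lambda>x. ennreal (h x)))) \<noteq> \<infinity>"
    by auto
qed

section \<open>Absolutely continuous part, its norm and Hellinger integrals for densities
  \<open>g\<close> and \<open>1 - g\<close>\<close>

context
  fixes L :: "'a measure" and g :: "'a \<Rightarrow> real"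
  assumes fin: "finite_measure L" and g [measurable]: "g \<in> borel_measurable L"
    and g0: "\<And>x. 0 \<le> g x" and g1: "\<And>x. g x \<le> 1"
begin

text \<open>With \<open>x / 0 = 0\<close>, the quotient \<open>g / (1 - g)\<close> vanishes on \<open>{g = 1}\<close>, which carries the singular part.\<close>

lemma ac_part_densities:
  "ac_part (density L (\<lambda>x. ennreal (g x))) (density L (\<lambda>x. ennreal (1 - g x)))
    = density (density L (\<lambda>x. ennreal (1 - g x))) (\<lambda>x. ennreal (g x / (1 - g x)))"
  (is "ac_part ?P ?Q = ?a")
proof -
  define N where "N = {x\<in>space L. g x = 1}"
  have [measurable]: "N \<in> sets L" by (simp add: N_def)
  \<comment> \<open>The first measure restricted to \<open>N\<close>, where its density
    \<open>g\<close> equals 1; the second measure gives \<open>N\<close> mass 0.\<close>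
  define s where "s = density L (indicator N)"
  have "lebesgue_decomposition ?P ?Q ?a s"
    unfolding lebesgue_decomposition_def
  proof (intro conjI ballI)
    show "sets ?a = sets ?Q" "sets s = sets ?Q" by (simp_all add: s_def)
    show "absolutely_continuous ?Q ?a" by (rule absolutely_continuousI_density) simp
    have "emeasure ?Q N = 0"
      by (subst emeasure_density) (auto simp: N_def indicator_def nn_integral_0_iff_AE)
    moreover have "emeasure s (space L - N) = 0"
      by (simp add: s_def emeasure_density flip: indicator_inter_arith)
    ultimately show "mutually_singular s ?Q"
      unfolding mutually_singular_def by (intro bexI[of _ N]) auto
    fix A assume "A \<in> sets ?Q"
    then have [measurable]: "A \<in> sets L" by simp
    have "emeasure ?a A + emeasure s A =
        (\<integral>\<^sup>+x. ennreal (1 - g x) * (ennreal (g x / (1 - g x)) * indicator A x) \<partial>L) + (\<integral>\<^sup>+x. indicator N x * indicator A x \<partial>L)"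
      by (simp add: s_def emeasure_density nn_integral_density)
    also have "\<dots> = (\<integral>\<^sup>+x. ennreal (1 - g x) * (ennreal (g x / (1 - g x)) * indicator A x) + indicator N x * indicator A x \<partial>L)"
      by (rule nn_integral_add[symmetric]) auto
    also have "\<dots> = (\<integral>\<^sup>+x. ennreal (g x) * indicator A x \<partial>L)"
    proof (rule nn_integral_cong)
      fix x assume "x \<in> space L"
      then show "ennreal (1 - g x) * (ennreal (g x / (1 - g x)) * indicator A x) + indicator N x * indicator A x
          = ennreal (g x) * indicator A x"
        using g0[of x] g1[of x] by (cases "g x = 1") (auto simp: N_def indicator_def ennreal_mult[symmetric])
    qed
    also have "\<dots> = emeasure ?P A" by (simp add: emeasure_density)
    finally show "emeasure ?P A = emeasure ?a A + emeasure s A" by simp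
  qed
  moreover have "finite_measure ?P" by (rule finite_measure_density_le_1[OF fin]) (auto simp: g1)
  then obtain s' where "lebesgue_decomposition ?P ?Q (ac_part ?P ?Q) s'"
    using lebesgue_decomposition_ac_part[of ?P ?Q] by auto
  ultimately show ?thesis using lebesgue_decomposition_unique by blast
qed

text \<open>The explicit quotient represents the absolutely continuous part, and such a density is
  unique almost everywhere for a finite reference measure.\<close>

lemma ac_density_densities:
  "AE x in density L (\<lambda>x. ennreal (1 - g x)).
    ac_density (density L (\<lambda>x. ennreal (g x))) (density L (\<lambda>x. ennreal (1 - g x))) x = ennreal (g x / (1 - g x))"
proof -
  interpret finite_measure "density L (\<lambda>x. ennreal (1 - g x))"
    by (rule finite_measure_density_le_1[OF fin]) (auto simp: g0)
  show ?thesis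
    unfolding ac_density_def
    by (rule AE_symmetric[OF RN_deriv_unique]) (auto simp: ac_part_densities)
qed

text \<open>Written over \<open>L\<close>, the total mass has a factor \<open>1 - g\<close> that
  cancels the denominator where \<open>g < 1\<close> and kills the integrand where
  \<open>g = 1\<close>.\<close>

lemma norm_ac_part_densities:
  "total_variation_norm (ac_part (density L (\<lambda>x. ennreal (g x))) (density L (\<lambda>x. ennreal (1 - g x))))
    = (\<integral>\<^sup>+x. ennreal (if g x < 1 then g x else 0) \<partial>L)"
proof -
  have "total_variation_norm (ac_part (density L (\<lambda>x. ennreal (g x))) (density L (\<lambda>x. ennreal (1 - g x))))
      = (\<integral>\<^sup>+x. ennreal (1 - g x) * (ennreal (g x / (1 - g x)) * indicator (space L) x) \<partial>L)"
    unfolding total_variation_norm_eq ac_part_densities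
    by (simp add: emeasure_density nn_integral_density)
  also have "\<dots> = (\<integral>\<^sup>+x. ennreal (if g x < 1 then g x else 0) \<partial>L)"
  proof (rule nn_integral_cong)
    fix x assume "x \<in> space L"
    then show "ennreal (1 - g x) * (ennreal (g x / (1 - g x)) * indicator (space L) x)
        = ennreal (if g x < 1 then g x else 0)"
      using g0[of x] g1[of x] by (auto simp: ennreal_mult[symmetric])
  qed
  finally show ?thesis .
qed

lemma hellinger_integral_densities:
  assumes "\<alpha> < 1"
  shows "hellinger_integral \<alpha> (density L (\<lambda>x. ennreal (g x))) (density L (\<lambda>x. ennreal (1 - g x)))
    = (\<integral>\<^sup>+x. ennreal (g x powr \<alpha> * (1 - g x) powr (1 - \<alpha>)) \<partial>L)"
proof -
  let ?P = "density L (\<lambda>x. ennreal (g x))" and ?Q = "density L (\<lambda>x. ennreal (1 - g x))"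
  have "hellinger_integral \<alpha> ?P ?Q = (\<integral>\<^sup>+x. ennreal ((g x / (1 - g x)) powr \<alpha>) \<partial>?Q)"
    unfolding hellinger_integral_def using ac_density_densities
    by (intro nn_integral_cong_AE) (auto simp: g0 g1 elim!: eventually_mono)
  also have "\<dots> = (\<integral>\<^sup>+x. ennreal (1 - g x) * ennreal ((g x / (1 - g x)) powr \<alpha>) \<partial>L)"
    by (rule nn_integral_density) auto
  also have "\<dots> = (\<integral>\<^sup>+x. ennreal (g x powr \<alpha> * (1 - g x) powr (1 - \<alpha>)) \<partial>L)"
  proof (rule nn_integral_cong)
    \<comment> \<open>At \<open>g x = 1\<close> both sides are 0, the right one because
      \<open>0 powr _ = 0\<close>; elsewhere the exponents of \<open>1 - g x\<close>
      combine.\<close>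
    fix x
    show "ennreal (1 - g x) * ennreal ((g x / (1 - g x)) powr \<alpha>) = ennreal (g x powr \<alpha> * (1 - g x) powr (1 - \<alpha>))"
      using g0[of x] g1[of x] assms
      by (cases "g x = 1") (auto simp: ennreal_mult[symmetric] powr_divide powr_diff field_simps)
  qed
  finally show ?thesis .
qed

end

text \<open>The restricted measure sees \<open>u\<close> only through its integrals over sets of
  \<open>F\<close>, and these are the integrals of \<open>v\<close>. Since \<open>v\<close> is
  measurable for \<open>F\<close>, they can be taken over the restriction of
  \<open>L\<close>.\<close>

lemma restr_to_subalg_density:
  fixes u v :: "'a \<Rightarrow> real"
  assumes L: "finite_measure L" and sub: "subalgebra L F"
    and u [measurable]: "u \<in> borel_measurable L" and v: "v \<in> borel_measurable F"
    and bounds: "\<And>x. 0 \<le> u x" "\<And>x. u x \<le> 1" "\<And>x. 0 \<le> v x" "\<And>x. v x \<le> 1"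
    and eq: "\<And>A. A \<in> sets F \<Longrightarrow> (\<integral>x\<in>A. u x \<partial>L) = (\<integral>x\<in>A. v x \<partial>L)"
  shows "restr_to_subalg (density L (\<lambda>x. ennreal (u x))) F = density (restr_to_subalg L F) (\<lambda>x. ennreal (v x))"
proof (rule measure_eqI)
  interpret finite_measure L by fact
  have vL [measurable]: "v \<in> borel_measurable L" using measurable_from_subalg[OF sub v] .
  have sub': "subalgebra (density L (\<lambda>x. ennreal (u x))) F" using sub by (simp add: subalgebra_def)
  show "sets (restr_to_subalg (density L (\<lambda>x. ennreal (u x))) F) = sets (density (restr_to_subalg L F) (\<lambda>x. ennreal (v x)))"
    using sub sub' by (simp add: sets_restr_to_subalg)
  fix A assume "A \<in> sets (restr_to_subalg (density L (\<lambda>x. ennreal (u x))) F)"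
  then have A: "A \<in> sets F" using sub' by (simp add: sets_restr_to_subalg)
  then have [measurable]: "A \<in> sets L" using sub by (auto simp: subalgebra_def)
  have int: "(\<integral>\<^sup>+x. ennreal (w x) * indicator A x \<partial>L) = ennreal (\<integral>x\<in>A. w x \<partial>L)"
    if [measurable]: "w \<in> borel_measurable L" and w: "\<And>x. 0 \<le> w x" "\<And>x. w x \<le> 1" for w
  proof -
    have "(\<integral>\<^sup>+x. ennreal (w x) * indicator A x \<partial>L) = (\<integral>\<^sup>+x. ennreal (indicator A x * w x) \<partial>L)"
      by (intro nn_integral_cong) (auto simp: indicator_def)
    also have "\<dots> = ennreal (\<integral>x. indicator A x * w x \<partial>L)"
      using w by (intro nn_integral_eq_integral integrable_const_bound[where B=1])
        (auto simp: indicator_def)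
    finally show ?thesis by (simp add: set_lebesgue_integral_def)
  qed
  have "emeasure (restr_to_subalg (density L (\<lambda>x. ennreal (u x))) F) A = (\<integral>\<^sup>+x. ennreal (u x) * indicator A x \<partial>L)"
    using A by (simp add: emeasure_restr_to_subalg[OF sub'] emeasure_density)
  also have "\<dots> = (\<integral>\<^sup>+x. ennreal (v x) * indicator A x \<partial>L)"
    using bounds eq[OF A] by (simp add: int)
  also have "\<dots> = (\<integral>\<^sup>+x. ennreal (v x) * indicator A x \<partial>restr_to_subalg L F)"
    using v A by (intro nn_integral_subalgebra2[symmetric] sub) auto
  also have "\<dots> = emeasure (density (restr_to_subalg L F) (\<lambda>x. ennreal (v x))) A"
    using v A sub by (intro emeasure_density[symmetric] measurable_in_subalg) (auto simp: sets_restr_to_subalg)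
  finally show "emeasure (restr_to_subalg (density L (\<lambda>x. ennreal (u x))) F) A
      = emeasure (density (restr_to_subalg L F) (\<lambda>x. ennreal (v x))) A" .
qed

section \<open>The double lower limit of Hellinger integrals\<close>

lemma powr_mult_powr_le_1:
  fixes y \<alpha> :: real
  assumes "0 \<le> y" "y \<le> 1" "0 < \<alpha>" "\<alpha> < 1"
  shows "y powr \<alpha> * (1 - y) powr (1 - \<alpha>) \<le> 1"
  using assms by (intro mult_le_one powr_le1) auto

lemma double_liminf_cong:
  assumes "\<And>x m. 0 < x \<Longrightarrow> x < 1 \<Longrightarrow> f x m = g x m"
  shows "double_liminf f = double_liminf g"
  unfolding double_liminf_def
proof (rule SUP_cong[OF refl], clarify)
  fix n :: nat and \<beta> :: real assume "\<beta> \<in> {0<..<1}"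
  then show "(INF (m, x)\<in>{n..} \<times> {\<beta>..<1}. f x m) = (INF (m, x)\<in>{n..} \<times> {\<beta>..<1}. g x m)"
    using assms by (intro INF_cong) auto
qed

text \<open>Since \<open>1 - l\<close> is nonzero, the second factor tends to
  \<open>(1 - l) powr 0 = 1\<close>. In the first, the exponent limit 1 is positive, which covers
  \<open>l = 0\<close>.\<close>

lemma tendsto_powr_mult_powr_1:
  fixes y x :: "nat \<Rightarrow> real"
  assumes "x \<longlonglongrightarrow> 1" "y \<longlonglongrightarrow> l" "\<And>n. 0 \<le> y n" "l < 1"
  shows "(\<lambda>k. y k powr x k * (1 - y k) powr (1 - x k)) \<longlonglongrightarrow> l"
proof -
  have l: "l \<ge> 0" using assms(2,3) by (intro LIMSEQ_le_const) auto
  have "(\<lambda>k. y k powr x k * (1 - y k) powr (1 - x k)) \<longlonglongrightarrow> l powr 1 * (1 - l) powr (1 - 1)"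
    using assms by (intro tendsto_mult tendsto_powr' tendsto_diff tendsto_const) auto
  then show ?thesis using assms(4) l by simp
qed

text \<open>The set where \<open>f = 1\<close> decides the form of the limit: at a fixed order below
  1 the integrand tends to 0 there, so taking \<open>n\<close> first loses this mass in the upper
  bound, while in the lower bound the target is 0 there anyway.\<close>

lemma double_liminf_powr_mult_powr:
  fixes g :: "nat \<Rightarrow> 'a \<Rightarrow> real" and f :: "'a \<Rightarrow> real"
  assumes L: "finite_measure L"
    and g [measurable]: "\<And>n. g n \<in> borel_measurable L" and f [measurable]: "f \<in> borel_measurable L"
    and g01: "\<And>n x. 0 \<le> g n x" "\<And>n x. g n x \<le> 1"
    and f01: "\<And>x. 0 \<le> f x" "\<And>x. f x \<le> 1"
    and lim: "AE x in L. (\<lambda>n. g n x) \<longlonglongrightarrow> f x"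
  shows "double_liminf (\<lambda>\<alpha> n. \<integral>\<^sup>+x. ennreal (g n x powr \<alpha> * (1 - g n x) powr (1 - \<alpha>)) \<partial>L)
    = (\<integral>\<^sup>+x. ennreal (if f x < 1 then f x else 0) \<partial>L)"
  (is "double_liminf ?H = ?c")
proof (rule antisym)
  interpret finite_measure L by fact
  have one: "(\<integral>\<^sup>+x. 1 \<partial>L) < \<infinity>" by (simp add: less_top[symmetric])
  show "double_liminf ?H \<le> ?c"
    unfolding double_liminf_def
  proof (rule SUP_least, clarify)
    fix n :: nat and \<beta> :: real assume \<beta>: "\<beta> \<in> {0<..<1}"
    let ?I = "INF (m, x)\<in>{n..} \<times> {\<beta>..<1}. ?H x m"
    \<comment> \<open>A sequence of admissible orders starting at \<open>\<beta>\<close> and tending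
      to 1.\<close>
    define a where "a k = 1 - (1 - \<beta>) / real (Suc k)" for k
    have a: "\<beta> \<le> a k" "a k < 1" "0 < a k" for k
    proof -
      have "(1 - \<beta>) / real (Suc k) \<le> (1 - \<beta>) / 1"
        using \<beta> by (intro divide_left_mono) auto
      moreover have "(1 - \<beta>) / real (Suc k) > 0" using \<beta> by simp
      ultimately show "\<beta> \<le> a k" "a k < 1" "0 < a k" using \<beta> by (auto simp: a_def)
    qed
    have "(\<lambda>k. 1 - (1 - \<beta>) / real (Suc k)) \<longlonglongrightarrow> 1 - 0"
      by (intro tendsto_intros LIMSEQ_Suc[OF lim_const_over_n])
    then have a_lim: "a \<longlonglongrightarrow> 1" by (simp add: a_def[abs_def])
    have I_le: "?I \<le> (\<integral>\<^sup>+x. ennreal (f x powr a k * (1 - f x) powr (1 - a k)) \<partial>L)" for k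
    proof (rule LIMSEQ_le_const)
      show "\<exists>N. \<forall>m\<ge>N. ?I \<le> ?H (a k) m"
        using a[of k] by (intro exI[of _ n] allI impI INF_lower2[where i="(_, a k)"]) auto
      show "(\<lambda>m. ?H (a k) m) \<longlonglongrightarrow> (\<integral>\<^sup>+x. ennreal (f x powr a k * (1 - f x) powr (1 - a k)) \<partial>L)"
      proof (rule nn_integral_dominated_convergence[where w="\<lambda>_. 1"])
        show "AE x in L. ennreal (g m x powr a k * (1 - g m x) powr (1 - a k)) \<le> 1" for m
          using powr_mult_powr_le_1[OF g01 a(3,2)] by simp
        show "AE x in L. (\<lambda>m. ennreal (g m x powr a k * (1 - g m x) powr (1 - a k)))
            \<longlonglongrightarrow> ennreal (f x powr a k * (1 - f x) powr (1 - a k))"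
          using lim
        proof eventually_elim
          case (elim x)
          then show ?case using g01 a[of k]
            by (intro tendsto_ennrealI tendsto_mult tendsto_powr' tendsto_diff tendsto_const) auto
        qed
      qed (use one in auto)
    qed
    have "(\<lambda>k. \<integral>\<^sup>+x. ennreal (f x powr a k * (1 - f x) powr (1 - a k)) \<partial>L) \<longlonglongrightarrow> ?c"
    proof (rule nn_integral_dominated_convergence[where w="\<lambda>_. 1"])
      show "AE x in L. ennreal (f x powr a k * (1 - f x) powr (1 - a k)) \<le> 1" for k
        using powr_mult_powr_le_1[OF f01 a(3,2)] by simp
      show "AE x in L. (\<lambda>k. ennreal (f x powr a k * (1 - f x) powr (1 - a k)))
          \<longlonglongrightarrow> ennreal (if f x < 1 then f x else 0)"
      proof (rule AE_I2)
        fix x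
        show "(\<lambda>k. ennreal (f x powr a k * (1 - f x) powr (1 - a k)))
          \<longlonglongrightarrow> ennreal (if f x < 1 then f x else 0)"
        proof (cases "f x < 1")
          case True
          then show ?thesis
            using tendsto_powr_mult_powr_1[OF a_lim, of "\<lambda>_. f x" "f x"] f01 by (auto intro: tendsto_ennrealI)
        next
          case False
          \<comment> \<open>The base \<open>1 - f x\<close> is 0, so every term vanishes, as does
            the limit.\<close>
          then have "f x = 1" using f01(2)[of x] by simp
          then show ?thesis by simp
        qed
      qed
    qed (use one in auto)
    then show "?I \<le> ?c" by (rule LIMSEQ_le_const) (use I_le in auto)
  qed
  show "?c \<le> double_liminf ?H"
  proof (rule ccontr)
    assume "\<not> ?c \<le> double_liminf ?H"
    then obtain d where d: "double_liminf ?H < d" "d < ?c"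
      using dense[of "double_liminf ?H" ?c] by (auto simp: not_le)
    \<comment> \<open>Each tail infimum is below \<open>d\<close>, hence some pair in the tail is
      too. The shift \<open>k + 2\<close> keeps the lower end for the orders inside the open unit
      interval already at \<open>k = 0\<close>.\<close>
    have "\<exists>p. fst p \<ge> k \<and> 1 - 1 / real (k + 2) \<le> snd p \<and> snd p < 1 \<and> ?H (snd p) (fst p) < d" for k
    proof -
      have "(INF (m, x)\<in>{k..} \<times> {1 - 1 / real (k + 2)..<1}. ?H x m) \<le> double_liminf ?H"
        unfolding double_liminf_def
        by (rule SUP_upper2[where i="(k, 1 - 1 / real (k + 2))"]) auto
      then have "(INF (m, x)\<in>{k..} \<times> {1 - 1 / real (k + 2)..<1}. ?H x m) < d" using d(1) by (rule le_less_trans)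
      then obtain m x where "m \<ge> k" "1 - 1 / real (k + 2) \<le> x" "x < 1" "?H x m < d"
        by (subst (asm) INF_less_iff) auto
      then show ?thesis by (intro exI[of _ "(m, x)"]) simp
    qed
    then have "\<exists>p. \<forall>k. fst (p k) \<ge> k \<and> 1 - 1 / real (k + 2) \<le> snd (p k) \<and> snd (p k) < 1
        \<and> ?H (snd (p k)) (fst (p k)) < d"
      by (intro choice allI)
    then obtain p where p: "\<forall>k. fst (p k) \<ge> k \<and> 1 - 1 / real (k + 2) \<le> snd (p k) \<and> snd (p k) < 1
        \<and> ?H (snd (p k)) (fst (p k)) < d" ..
    define m x where "m k = fst (p k)" and "x k = snd (p k)" for k
    have mx: "m k \<ge> k" "1 - 1 / real (k + 2) \<le> x k" "x k < 1" "?H (x k) (m k) < d" for k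
      using p[rule_format, of k] unfolding m_def x_def by blast+
    \<comment> \<open>The chosen indices need not increase; \<open>m k \<ge> k\<close> is enough to
      compose with the pointwise limit.\<close>
    have m_lim: "filterlim m at_top sequentially"
      by (rule filterlim_at_top_mono[OF filterlim_ident]) (use mx(1) in auto)
    have x_lim: "x \<longlonglongrightarrow> 1"
    proof (rule real_tendsto_sandwich)
      have "(\<lambda>k. 1 - 1 / real (k + 2)) \<longlonglongrightarrow> 1 - 0"
        by (intro tendsto_intros LIMSEQ_ignore_initial_segment[OF lim_const_over_n])
      then show "(\<lambda>k. 1 - 1 / real (k + 2)) \<longlonglongrightarrow> 1" by simp
      show "\<forall>\<^sub>F k in sequentially. 1 - 1 / real (k + 2) \<le> x k" using mx(2) by (intro always_eventually allI)
      show "\<forall>\<^sub>F k in sequentially. x k \<le> 1" using mx(3) by (intro always_eventually allI less_imp_le)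
      show "(\<lambda>_. 1) \<longlonglongrightarrow> (1 :: real)" by (rule tendsto_const)
    qed
    let ?h = "\<lambda>k y. ennreal (g (m k) y powr x k * (1 - g (m k) y) powr (1 - x k))"
    \<comment> \<open>Fatou's lemma along the chosen pairs bounds \<open>?c\<close> by
      \<open>d\<close>, against the choice of \<open>d\<close>.\<close>
    have "?c \<le> (\<integral>\<^sup>+y. liminf (\<lambda>k. ?h k y) \<partial>L)"
    proof (rule nn_integral_mono_AE)
      show "AE y in L. ennreal (if f y < 1 then f y else 0) \<le> liminf (\<lambda>k. ?h k y)"
        using lim
      proof eventually_elim
        case (elim y)
        show ?case
        proof (cases "f y < 1")
          case True
          have "(\<lambda>k. g (m k) y) \<longlonglongrightarrow> f y" using elim m_lim by (rule filterlim_compose)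
          then have "(\<lambda>k. ?h k y) \<longlonglongrightarrow> ennreal (f y)"
            using True g01 by (intro tendsto_ennrealI tendsto_powr_mult_powr_1 x_lim) auto
          then show ?thesis using True by (simp add: lim_imp_Liminf)
        qed simp
      qed
    qed
    also have "\<dots> \<le> liminf (\<lambda>k. ?H (x k) (m k))" by (rule nn_integral_liminf) simp
    also have "\<dots> \<le> d" by (rule Liminf_le, simp, intro always_eventually allI less_imp_le mx(4))
    finally show False using d(2) by simp
  qed
qed

text \<open>The time-free core: all restrictions are expressed by densities over one measure
  \<open>L\<close>, where Levy's theorem links those of the restrictions to that of the full
  measures.\<close>

theorem ac_part_generating_filtration:
  fixes P Q :: "'a measure" and G :: "nat \<Rightarrow> 'a measure"
  assumes P: "finite_measure P" and Q: "finite_measure Q" and sets: "sets P = sets Q"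
    and sub: "\<And>n. subalgebra P (G n)"
    and mono: "\<And>m n. m \<le> n \<Longrightarrow> sets (G m) \<subseteq> sets (G n)"
    and generates: "sets P = sigma_sets (space P) (\<Union>n. sets (G n))"
  shows norm_ac_part_eq_double_liminf: "total_variation_norm (ac_part P Q)
      = double_liminf (\<lambda>\<alpha> n. hellinger_integral \<alpha> (restr_to_subalg P (G n)) (restr_to_subalg Q (G n)))"
    and ac_density_tendsto: "AE x in Q.
      (\<lambda>n. ac_density (restr_to_subalg P (G n)) (restr_to_subalg Q (G n)) x) \<longlonglongrightarrow> ac_density P Q x"
proof -
  obtain L and f :: "'a \<Rightarrow> real" where L: "finite_measure L" and sets_L: "sets L = sets P"
    and f [measurable]: "f \<in> borel_measurable L" and f01: "\<And>x. 0 \<le> f x" "\<And>x. f x \<le> 1"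
    and Pf: "P = density L (\<lambda>x. ennreal (f x))" and Qf: "Q = density L (\<lambda>x. ennreal (1 - f x))"
    by (rule dominating_densities_exist[OF P Q sets]) (rule that)
  interpret finite_measure L by fact
  have sp: "space L = space P" using sets_L by (rule sets_eq_imp_space_eq)
  interpret generating_filtration L G
    using sub mono generates by unfold_locales (auto simp: subalgebra_def sp sets_L)
  have int_f: "integrable L f" using f01 by (intro integrable_const_bound[where B=1]) auto
  \<comment> \<open>The library only bounds conditional expectations almost everywhere, hence the truncation.\<close>
  define g where "g n x = max 0 (min 1 (real_cond_exp L (G n) f x))" for n x
  have gG: "g n \<in> borel_measurable (G n)" for n unfolding g_def by measurable
  have g_L [measurable]: "g n \<in> borel_measurable L" for n using measurable_from_subalg[OF subalg gG] .
  have g01: "0 \<le> g n x" "g n x \<le> 1" for n x by (auto simp: g_def)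
  have g_eq: "AE x in L. real_cond_exp L (G n) f x = g n x" for n
  proof -
    interpret E: sigma_finite_subalgebra L "G n" by (rule sigma_finite_subalgebra)
    have "AE x in L. real_cond_exp L (G n) f x \<ge> 0" "AE x in L. real_cond_exp L (G n) f x \<le> 1"
      using f01 by (auto intro!: E.real_cond_exp_ge_c E.real_cond_exp_le_c int_f)
    then show ?thesis by eventually_elim (simp add: g_def)
  qed
  have g_int: "(\<integral>x\<in>A. f x \<partial>L) = (\<integral>x\<in>A. g n x \<partial>L)" if A: "A \<in> sets (G n)" for A n
  proof -
    interpret E: sigma_finite_subalgebra L "G n" by (rule sigma_finite_subalgebra)
    have "A \<in> sets L" using A sets_G by blast
    have "(\<integral>x\<in>A. f x \<partial>L) = (\<integral>x\<in>A. real_cond_exp L (G n) f x \<partial>L)"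
      by (rule E.real_cond_exp_intA[OF int_f A])
    also have "\<dots> = (\<integral>x\<in>A. g n x \<partial>L)"
      unfolding set_lebesgue_integral_def
    proof (rule integral_cong_AE)
      have [measurable]: "real_cond_exp L (G n) f \<in> borel_measurable L" by simp
      show "(\<lambda>x. indicator A x *\<^sub>R real_cond_exp L (G n) f x) \<in> borel_measurable L"
        "(\<lambda>x. indicator A x *\<^sub>R g n x) \<in> borel_measurable L"
        using \<open>A \<in> sets L\<close> by measurable
      show "AE x in L. indicator A x *\<^sub>R real_cond_exp L (G n) f x = indicator A x *\<^sub>R g n x"
        using g_eq[of n] by eventually_elim simp
    qed
    finally show ?thesis .
  qed
  have g_lim: "AE x in L. (\<lambda>n. g n x) \<longlonglongrightarrow> f x"
  proof -
    have "AE x in L. \<forall>n. real_cond_exp L (G n) f x = g n x"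
      unfolding AE_all_countable using g_eq by blast
    with real_cond_exp_tendsto[OF int_f] show ?thesis by eventually_elim simp
  qed
  have PG: "restr_to_subalg P (G n) = density (restr_to_subalg L (G n)) (\<lambda>x. ennreal (g n x))" for n
    unfolding Pf by (rule restr_to_subalg_density[OF L subalg f gG f01 g01 g_int])
  have QG: "restr_to_subalg Q (G n) = density (restr_to_subalg L (G n)) (\<lambda>x. ennreal (1 - g n x))" for n
    unfolding Qf
  proof (rule restr_to_subalg_density[OF L subalg])
    show "(\<lambda>x. 1 - g n x) \<in> borel_measurable (G n)" using gG by measurable
    fix A assume A: "A \<in> sets (G n)"
    then have AL: "A \<in> sets L" using sets_G by blast
    have int_g: "integrable L (g n)" using g01 by (intro integrable_const_bound[where B=1]) auto
    have "set_integrable L A (\<lambda>x. 1 :: real)" "set_integrable L A f" "set_integrable L A (g n)"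
      unfolding set_integrable_def using AL int_f int_g
      by (intro integrable_mult_indicator; simp)+
    then show "(\<integral>x\<in>A. 1 - f x \<partial>L) = (\<integral>x\<in>A. 1 - g n x \<partial>L)"
      using g_int[OF A] by (simp add: set_integral_diff)
  qed (use f01 g01 in auto)
  have fin_n: "finite_measure (restr_to_subalg L (G n))" for n
    by (rule finite_measure_restr_to_subalg[OF subalg L])
  have g_n: "g n \<in> borel_measurable (restr_to_subalg L (G n))" for n
    by (rule measurable_in_subalg[OF subalg gG])
  \<comment> \<open>The integrand depends on \<open>g n\<close> alone and is thus measurable for
    \<open>G n\<close>, so the integral over the restriction is one over the fixed measure
    \<open>L\<close>.\<close>
  have H: "hellinger_integral \<alpha> (restr_to_subalg P (G n)) (restr_to_subalg Q (G n))
      = (\<integral>\<^sup>+x. ennreal (g n x powr \<alpha> * (1 - g n x) powr (1 - \<alpha>)) \<partial>L)" if "\<alpha> < 1" for \<alpha> n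
  proof -
    have "hellinger_integral \<alpha> (restr_to_subalg P (G n)) (restr_to_subalg Q (G n))
      = (\<integral>\<^sup>+x. ennreal (g n x powr \<alpha> * (1 - g n x) powr (1 - \<alpha>)) \<partial>restr_to_subalg L (G n))"
      unfolding PG QG by (rule hellinger_integral_densities[OF fin_n g_n g01 that])
    also have "\<dots> = (\<integral>\<^sup>+x. ennreal (g n x powr \<alpha> * (1 - g n x) powr (1 - \<alpha>)) \<partial>L)"
      by (intro nn_integral_subalgebra2[OF subalg[of n]] measurable_compose[OF gG]) measurable
    finally show ?thesis .
  qed
  have "total_variation_norm (ac_part P Q) = (\<integral>\<^sup>+x. ennreal (if f x < 1 then f x else 0) \<partial>L)"
    unfolding Pf Qf by (rule norm_ac_part_densities[OF L f f01])
  also have "\<dots> = double_liminf (\<lambda>\<alpha> n. \<integral>\<^sup>+x. ennreal (g n x powr \<alpha> * (1 - g n x) powr (1 - \<alpha>)) \<partial>L)"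
    by (rule double_liminf_powr_mult_powr[OF L g_L f g01 f01 g_lim, symmetric])
  also have "\<dots> = double_liminf (\<lambda>\<alpha> n. hellinger_integral \<alpha> (restr_to_subalg P (G n)) (restr_to_subalg Q (G n)))"
    by (rule double_liminf_cong) (simp add: H)
  finally show "total_variation_norm (ac_part P Q)
      = double_liminf (\<lambda>\<alpha> n. hellinger_integral \<alpha> (restr_to_subalg P (G n)) (restr_to_subalg Q (G n)))" .
  have subQ: "subalgebra Q (G n)" for n
    using sub[of n] sets sets_eq_imp_space_eq[OF sets] by (simp add: subalgebra_def)
  have "AE x in Q. \<forall>n. ac_density (restr_to_subalg P (G n)) (restr_to_subalg Q (G n)) x = ennreal (g n x / (1 - g n x))"
    unfolding AE_all_countable
  proof
    fix n
    have "AE x in restr_to_subalg Q (G n). ac_density (restr_to_subalg P (G n)) (restr_to_subalg Q (G n)) x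
        = ennreal (g n x / (1 - g n x))"
      unfolding PG QG by (rule ac_density_densities[OF fin_n g_n g01])
    then show "AE x in Q. ac_density (restr_to_subalg P (G n)) (restr_to_subalg Q (G n)) x = ennreal (g n x / (1 - g n x))"
      by (rule AE_restr_to_subalg[OF subQ])
  qed
  moreover have "AE x in Q. ac_density P Q x = ennreal (f x / (1 - f x))"
    unfolding Pf Qf by (rule ac_density_densities[OF L f f01])
  \<comment> \<open>\<open>Q\<close> has density \<open>1 - f\<close>, so it does not charge
    \<open>f = 1\<close>. Almost everywhere the limiting denominator is therefore nonzero and the
    quotients converge.\<close>
  moreover have "AE x in Q. f x < 1 \<and> (\<lambda>n. g n x) \<longlonglongrightarrow> f x"
    unfolding Qf by (subst AE_density) (use g_lim in \<open>auto elim!: eventually_mono\<close>)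
  ultimately show "AE x in Q.
      (\<lambda>n. ac_density (restr_to_subalg P (G n)) (restr_to_subalg Q (G n)) x) \<longlonglongrightarrow> ac_density P Q x"
  proof eventually_elim
    case (elim x)
    then have "(\<lambda>n. ennreal (g n x / (1 - g n x))) \<longlonglongrightarrow> ennreal (f x / (1 - f x))"
      by (intro tendsto_ennrealI tendsto_intros) auto
    then show ?case using elim by simp
  qed
qed

section \<open>The strict past as the join of the sigma-algebras at the announcing times\<close>

section \<open>The strict past of a predictable time\<close>

text \<open>For \<open>t\<close> at least \<open>s\<close>, monotonicity puts \<open>A\<close> into
  \<open>F t\<close> along with the event \<open>S \<le> t\<close>; for other \<open>t\<close> the
  intersection is empty.\<close>

lemma (in filtration) F_subset_pre_sigma:
  assumes S: "stopping_time F S" and A: "A \<in> sets (F s)" "\<And>\<omega>. \<omega> \<in> A \<Longrightarrow> s \<le> S \<omega>"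
  shows "A \<in> sets (pre_sigma S)"
proof (rule sets_pre_sigmaI[OF S])
  fix t
  show "{\<omega>\<in>A. S \<omega> \<le> t} \<in> sets (F t)"
  proof (cases "s \<le> t")
    case True
    then have "A \<inter> {\<omega>\<in>space (F t). S \<omega> \<le> t} \<in> sets (F t)"
      using A(1) sets_F_mono[OF True] stopping_timeD[OF S, of t] by (auto simp: pred_def)
    also have "A \<inter> {\<omega>\<in>space (F t). S \<omega> \<le> t} = {\<omega>\<in>A. S \<omega> \<le> t}"
      using sets.sets_into_space[OF A(1)] by (auto simp: space_F)
    finally show ?thesis .
  next
    case False
    then have "{\<omega>\<in>A. S \<omega> \<le> t} = {}" using A(2) by fastforce
    then show ?thesis by (simp only: sets.empty_sets)
  qed
qed

context right_continuous_filtered_space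
begin

lemma sets_F_subset: "sets (F t) \<subseteq> sets M"
  using sets_F_mono[of t \<infinity>] unfolding sets_F_top by simp

lemma strict_past_generators:
  "sets (F 0) \<union> {A \<inter> {\<omega> \<in> space M. t < T \<omega>} | A t. t < \<infinity> \<and> A \<in> sets (F t)} \<subseteq> Pow (space M)"
  using sets.sets_into_space[of _ "F 0"] unfolding space_F by blast

lemma space_strict_past: "space (strict_past (space M) F T) = space M"
  unfolding strict_past_def by (rule space_measure_of[OF strict_past_generators])

lemma sets_strict_past:
  "sets (strict_past (space M) F T) =
    sigma_sets (space M) (sets (F 0) \<union> {A \<inter> {\<omega> \<in> space M. t < T \<omega>} | A t. t < \<infinity> \<and> A \<in> sets (F t)})"
  unfolding strict_past_def by (rule sets_measure_of[OF strict_past_generators])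

lemma strict_pastI:
  assumes "A \<in> sets (F t)" "t < \<infinity>"
  shows "A \<inter> {\<omega> \<in> space M. t < T \<omega>} \<in> sets (strict_past (space M) F T)"
  unfolding sets_strict_past using assms by (intro sigma_sets.Basic) blast

context
  fixes T V
  assumes ann: "announcing_sequence (space M) F T V"
begin

lemma announcing_stopping_time: "stopping_time F (V n)"
  using ann unfolding announcing_sequence_def by blast

context
  fixes \<omega> assumes \<omega>: "\<omega> \<in> space M"
begin

lemma announcing_incseq: "incseq (\<lambda>n. V n \<omega>)"
  and announcing_tendsto: "(\<lambda>n. V n \<omega>) \<longlonglongrightarrow> T \<omega>"
  and announcing_less: "0 < T \<omega> \<Longrightarrow> V n \<omega> < T \<omega>"
  using ann \<omega> unfolding announcing_sequence_def by blast+

lemma announcing_le: "V n \<omega> \<le> T \<omega>"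
  by (rule incseq_le[OF announcing_incseq announcing_tendsto])

lemma announcing_exceeds: "t < T \<omega> \<Longrightarrow> \<exists>n. t < V n \<omega>"
  by (rule eventually_happens'[OF _ order_tendstoD(1)[OF announcing_tendsto]]) simp

end

text \<open>Where \<open>T\<close> is positive, \<open>V n < T\<close> leaves room for a point
  \<open>d\<close> of a countable set with \<open>V n \<le> d < T\<close>. There \<open>A\<close> is
  a countable union of generators, each the part of \<open>A\<close> with \<open>V n \<le> d\<close>
  cut by \<open>d < T\<close>.\<close>

lemma pre_sigma_subset_strict_past:
  "sets (pre_sigma (V n)) \<subseteq> sets (strict_past (space M) F T)"
proof
  fix A assume A: "A \<in> sets (pre_sigma (V n))"
  let ?S = "strict_past (space M) F T"
  obtain D :: "ennreal set" where D: "countable D" "\<And>x y. x < y \<Longrightarrow> \<exists>d\<in>D. x \<le> d \<and> d < y"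
    using countable_separating_set_linorder2 by blast
  note V = announcing_stopping_time
  have A_sub: "A \<subseteq> space M" using sets.sets_into_space[OF A] by (simp add: space_pre_sigma)
  have le: "{\<omega>\<in>A. V n \<omega> \<le> t} \<in> sets (F t)" for t by (rule sets_pre_sigmaD[OF V A])
  \<comment> \<open>This piece, minus the generator for \<open>t = 0\<close>, covers the points with
    \<open>T = 0\<close>, where \<open>V n\<close> is 0 too.\<close>
  have "{\<omega>\<in>A. V n \<omega> \<le> 0} \<in> sets ?S"
    unfolding sets_strict_past using le[of 0] by (intro sigma_sets.Basic UnI1)
  moreover have "space M \<inter> {\<omega> \<in> space M. 0 < T \<omega>} \<in> sets ?S"
    by (rule strict_pastI[where t=0]) (use sets.top[of "F 0"] in \<open>auto simp: space_F\<close>)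
  moreover have "(\<Union>t\<in>D \<inter> {..<\<infinity>}. {\<omega>\<in>A. V n \<omega> \<le> t} \<inter> {\<omega> \<in> space M. t < T \<omega>}) \<in> sets ?S"
  proof (rule sets.countable_UN'')
    show "{\<omega>\<in>A. V n \<omega> \<le> t} \<inter> {\<omega> \<in> space M. t < T \<omega>} \<in> sets ?S" if "t \<in> D \<inter> {..<\<infinity>}" for t
      using that by (intro strict_pastI le) simp
  qed (use D(1) in simp)
  ultimately have "({\<omega>\<in>A. V n \<omega> \<le> 0} - (space M \<inter> {\<omega> \<in> space M. 0 < T \<omega>}))
      \<union> (\<Union>t\<in>D \<inter> {..<\<infinity>}. {\<omega>\<in>A. V n \<omega> \<le> t} \<inter> {\<omega> \<in> space M. t < T \<omega>}) \<in> sets ?S"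
    by (intro sets.Un sets.Diff)
  also have "({\<omega>\<in>A. V n \<omega> \<le> 0} - (space M \<inter> {\<omega> \<in> space M. 0 < T \<omega>}))
      \<union> (\<Union>t\<in>D \<inter> {..<\<infinity>}. {\<omega>\<in>A. V n \<omega> \<le> t} \<inter> {\<omega> \<in> space M. t < T \<omega>}) = A"
    (is "?l = A")
  proof (intro equalityI subsetI)
    fix \<omega> assume \<omega>: "\<omega> \<in> A"
    then have sp: "\<omega> \<in> space M" using A_sub by auto
    show "\<omega> \<in> ?l"
    proof (cases "T \<omega> = 0")
      case True
      then show ?thesis using \<omega> announcing_le[OF sp, of n] by auto
    next
      case False
      then have "V n \<omega> < T \<omega>" by (intro announcing_less[OF sp]) (simp add: zero_less_iff_neq_zero)
      then obtain d where d: "d \<in> D" "V n \<omega> \<le> d" "d < T \<omega>" using D(2) by blast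
      \<comment> \<open>Generators use finite times; \<open>d < T\<close> excludes infinity even
        where \<open>T\<close> is infinite.\<close>
      then have "d < \<infinity>" by (metis infinity_ennreal_def order_less_le_trans top_greatest)
      then show ?thesis using d \<omega> sp by blast
    qed
  qed auto
  finally show "A \<in> sets ?S" .
qed

text \<open>As \<open>V n\<close> increases to \<open>T\<close>, the event \<open>t < T\<close> is
  the union of the events \<open>t < V n\<close>, and the part of a set of \<open>F t\<close> inside
  such an event is known at time \<open>V n\<close>.\<close>

lemma sets_strict_past_eq_pre_sigma:
  "sets (strict_past (space M) F T) = sigma_sets (space M) (\<Union>n. sets (pre_sigma (V n)))"
proof
  note V = announcing_stopping_time
  show "sigma_sets (space M) (\<Union>n. sets (pre_sigma (V n))) \<subseteq> sets (strict_past (space M) F T)"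
    using sets.sigma_sets_subset[of "\<Union>n. sets (pre_sigma (V n))" "strict_past (space M) F T"]
      pre_sigma_subset_strict_past by (auto simp: space_strict_past)
  show "sets (strict_past (space M) F T) \<subseteq> sigma_sets (space M) (\<Union>n. sets (pre_sigma (V n)))"
    unfolding sets_strict_past
  proof (rule sigma_sets_mono, safe)
    fix A assume "A \<in> sets (F 0)"
    then have "A \<in> sets (pre_sigma (V 0))" by (intro F_subset_pre_sigma[OF V]) auto
    then show "A \<in> sigma_sets (space M) (\<Union>n. sets (pre_sigma (V n)))" by blast
  next
    fix A t assume A: "A \<in> sets (F t)"
    have "A \<inter> {\<omega> \<in> space M. t < V n \<omega>} \<in> sets (pre_sigma (V n))" for n
      using A stopping_timeD2[OF V, of t n] by (intro F_subset_pre_sigma[OF V, of _ t]) (auto simp: pred_def space_F)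
    then have "(\<Union>n. A \<inter> {\<omega> \<in> space M. t < V n \<omega>}) \<in> sigma_sets (space M) (\<Union>n. sets (pre_sigma (V n)))"
      by (intro sigma_sets.Union sigma_sets.Basic) blast
    also have "(\<Union>n. A \<inter> {\<omega> \<in> space M. t < V n \<omega>}) = A \<inter> {\<omega> \<in> space M. t < T \<omega>}"
      using announcing_exceeds less_le_trans[OF _ announcing_le] by auto
    finally show "A \<inter> {\<omega> \<in> space M. t < T \<omega>} \<in> sigma_sets (space M) (\<Union>n. sets (pre_sigma (V n)))" .
  qed
qed

end

text \<open>For a stopping time the event \<open>t < T\<close> belongs to \<open>F t\<close>, so
  each generator is measurable.\<close>

lemma sets_strict_past_subset:
  assumes "stopping_time F T"
  shows "sets (strict_past (space M) F T) \<subseteq> sets M"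
  unfolding sets_strict_past
proof (rule sets.sigma_sets_subset, safe)
  fix A t assume "A \<in> sets (F t)"
  then have "A \<inter> {\<omega> \<in> space M. t < T \<omega>} \<in> sets (F t)"
    using stopping_timeD2[OF assms, of t] by (auto simp: pred_def space_F)
  then show "A \<inter> {\<omega> \<in> space M. t < T \<omega>} \<in> sets M" using sets_F_subset by blast
qed (use sets_F_subset in blast)

end

lemma restr_to_subalg_restr_to_subalg:
  assumes "subalgebra M F" "subalgebra F G"
  shows "restr_to_subalg (restr_to_subalg M F) G = restr_to_subalg M G"
proof -
  have 1: "subalgebra M G" using assms by (auto simp: subalgebra_def)
  have 2: "subalgebra (restr_to_subalg M F) G"
    using assms by (simp add: subalgebra_def space_restr_to_subalg sets_restr_to_subalg)
  show ?thesis
  proof (rule measure_eqI)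
    fix A assume "A \<in> sets (restr_to_subalg (restr_to_subalg M F) G)"
    then have "A \<in> sets G" by (simp add: sets_restr_to_subalg[OF 2])
    moreover then have "A \<in> sets F" using assms(2) by (auto simp: subalgebra_def)
    ultimately show "emeasure (restr_to_subalg (restr_to_subalg M F) G) A = emeasure (restr_to_subalg M G) A"
      by (simp add: emeasure_restr_to_subalg[OF 2] emeasure_restr_to_subalg[OF 1] emeasure_restr_to_subalg[OF assms(1)])
  qed (simp add: sets_restr_to_subalg[OF 2] sets_restr_to_subalg[OF 1])
qed

theorem corollary1:
  fixes M \<mu> \<nu> :: "'a measure"
    and F :: "ennreal \<Rightarrow> 'a measure"
    and T :: "'a \<Rightarrow> ennreal"
    and V :: "nat \<Rightarrow> 'a \<Rightarrow> ennreal"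
  defines "\<mu>T \<equiv> restr_to_subalg \<mu> (strict_past (space M) F T)"
    and "\<nu>T \<equiv> restr_to_subalg \<nu> (strict_past (space M) F T)"
    and "\<mu>V \<equiv> \<lambda>n. restr_to_subalg \<mu> (filtration.pre_sigma (space M) F (V n))"
    and "\<nu>V \<equiv> \<lambda>n. restr_to_subalg \<nu> (filtration.pre_sigma (space M) F (V n))"
  assumes "right_continuous_filtered_space M F"
    and "prob_space \<mu>" and "sets \<mu> = sets M"
    and "prob_space \<nu>" and "sets \<nu> = sets M"
    and "predictable_time (space M) F T"
    and "announcing_sequence (space M) F T V"
  shows "total_variation_norm (ac_part \<mu>T \<nu>T)
           = double_liminf (\<lambda>\<alpha> n. hellinger_integral \<alpha> (\<mu>V n) (\<nu>V n)) \<and>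
         (AE \<omega> in \<nu>T. (\<lambda>n. RN_deriv (\<nu>V n) (ac_part (\<mu>V n) (\<nu>V n)) \<omega>)
                         \<longlonglongrightarrow> RN_deriv \<nu>T (ac_part \<mu>T \<nu>T) \<omega>)"
proof -
  interpret right_continuous_filtered_space M F by fact
  let ?S = "strict_past (space M) F T"
  let ?G = "\<lambda>n. pre_sigma (V n)"
  have T: "stopping_time F T" using assms by (simp add: predictable_time_def)
  note ann = assms(11)
  have sp: "space \<mu> = space M" "space \<nu> = space M" by (rule sets_eq_imp_space_eq, fact)+
  have sub: "subalgebra \<mu> ?S" "subalgebra \<nu> ?S"
    using sets_strict_past_subset[OF T] assms by (auto simp: subalgebra_def space_strict_past sp)
  have subG: "subalgebra ?S (?G n)" for n
    using pre_sigma_subset_strict_past[OF ann] by (simp add: subalgebra_def space_strict_past space_pre_sigma)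
  have fin: "finite_measure \<mu>T" "finite_measure \<nu>T"
    unfolding \<mu>T_def \<nu>T_def using assms(6,8) sub
    by (auto intro: finite_measure_restr_to_subalg prob_space.finite_measure)
  have sets_T: "sets \<mu>T = sets ?S" "sets \<nu>T = sets ?S"
    by (simp_all add: \<mu>T_def \<nu>T_def sets_restr_to_subalg sub)
  have space_T: "space \<mu>T = space M" by (simp add: \<mu>T_def space_restr_to_subalg sp)
  \<comment> \<open>Restricting in two stages, first to the strict past, turns the measures at the
    announcing times into restrictions of \<open>\<mu>T\<close> and \<open>\<nu>T\<close>, the form
    required by the time-free result.\<close>
  have VT: "\<mu>V n = restr_to_subalg \<mu>T (?G n)" "\<nu>V n = restr_to_subalg \<nu>T (?G n)" for n
    unfolding \<mu>T_def \<nu>T_def \<mu>V_def \<nu>V_def by (simp_all add: restr_to_subalg_restr_to_subalg sub subG)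
  have sets_eq: "sets \<mu>T = sets \<nu>T" by (simp add: sets_T)
  have subT: "subalgebra \<mu>T (?G n)" for n
    using subG[of n] by (simp add: subalgebra_def sets_T space_T space_strict_past)
  have mono: "sets (?G m) \<subseteq> sets (?G n)" if "m \<le> n" for m n
    using announcing_stopping_time[OF ann] incseqD[OF announcing_incseq[OF ann] that]
    by (intro mono_pre_sigma)
  have gen: "sets \<mu>T = sigma_sets (space \<mu>T) (\<Union>n. sets (?G n))"
    unfolding sets_T space_T by (rule sets_strict_past_eq_pre_sigma[OF ann])
  note hyps = fin sets_eq subT mono gen
  show ?thesis
    using norm_ac_part_eq_double_liminf[OF hyps] ac_density_tendsto[OF hyps]
    by (simp add: VT ac_density_def)
qed

end
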